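(* Let $u \in \mathscr{C}^0([a,b],\mathbb{R}^m)$. Then $u$ is a critical point of the cost functional $\mathcal{L}^\alpha$ if and only if $(q^{u,\alpha},u,p^{u,\alpha})$ is a solution of the fractional stationary equation $$\frac{\partial H}{\partial v}(q,u,p,t)=0,$$ i.e. $\frac{\partial H}{\partial v}\big(q^{u,\alpha}(t),u(t),p^{u,\alpha}(t),t\big)=0$ for all $t\in[a,b]$.
   Context: Let $a<b$ be reals, $d,m\in\mathbb{N}^*$, $0<\alpha\le 1$, $A\in\mathbb{R}^d$; $\Vert\cdot\Vert$ is the Euclidean norm; $[\alpha]$ is the floor of $\alpha$ (so $\mathscr{C}^{[\alpha]}$ is $\mathscr{C}^0$ if $\alpha<1$ and $\mathscr{C}^1$ if $\alpha=1$). Fractional operators. For $g\in\mathscr{C}^0([a,b],\mathbb{R}^d)$ and $\beta>0$: $I^\beta_- g(t)=\frac{1}{\Gamma(\beta)}\int_a^t (t-y)^{\beta-1}g(y)\,dy$ for $t\in(a,b]$, and $I^\beta_+ g(t)=\frac{1}{\Gamma(\beta)}\int_t^b (y-t)^{\beta-1}g(y)\,dy$ for $t\in[a,b)$, extended continuously by $0$ at $a$, resp. $b$; $I^0_\pm g=g$. Riemann-Liouville derivatives: $D^\alpha_- g=\frac{d}{dt}(I^{1-\alpha}_- g)$ on $(a,b]$, $D^\alpha_+ g=-\frac{d}{dt}(I^{1-\alpha}_+ g)$ on $[a,b)$. Caputo derivatives: ${}_{\rm c}D^\alpha_- g=D^\alpha_-(g-g(a))$ on $(a,b]$, ${}_{\rm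 c}D^\alpha_+ g=D^\alpha_+(g-g(b))$ on $[a,b)$, whenever the right-hand sides are defined. A function defined on $(a,b]$ (resp. $[a,b)$) is regarded as an element of $\mathscr{C}^0([a,b],\mathbb{R}^d)$ if it is continuous there and extends continuously to $t=a$ (resp. $t=b$). Control problem. Elements $u\in\mathscr{C}^0([a,b],\mathbb{R}^m)$ are called controls. The constraint function $f:\mathbb{R}^d\times\mathbb{R}^m\times[a,b]\to\mathbb{R}^d$, $(x,v,t)\mapsto f(x,v,t)$, is $\mathscr{C}^2$ and there is $M\ge 0$ with $\Vert f(x_1,v,t)-f(x_2,v,t)\Vert\le M\Vert x_1-x_2\Vert$ for all $x_1,x_2\in\mathbb{R}^d$, $v\in\mathbb{R}^m$, $t\in[a,b]$. The Lagrangian $L:\mathbb{R}^d\times\mathbb{R}^m\times[a,b]\to\mathbb{R}$, $(x,v,t)\mapsto L(x,v,t)$, is $\mathscr{C}^2$. The Hamiltonian is $H:\mathbb{R}^d\times\mathbb{R}^m\times\mathbb{R}^d\times[a,b]\to\mathbb{R}$, $H(x,v,w,t)=L(x,v,t)+w\cdot f(x,v,t)$. For a control $u$, the state variable $q^{u,\alpha}\in\mathscr{C}^{[\alpha]}([a,b],\mathbb{R}^d)$ is the unique global solution of ${}_{\rm c}D^\alpha_- q=f(q,u,t)$, $q(a)=A$. The adjoint variable $p^{u,\alpha}\in\mathscr{C}^{[\alpha]}([a,b],\mathbb{R}^d)$ is the unique global solution of $${}_{\rm c}D^\alpha_+ p=\frac{\partial H}{\partial x}(q^{u,\alpha},u,p,t)=\frac{\partial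 L}{\partial x}(q^{u,\alpha},u,t)+\Big(\frac{\partial f}{\partial x}(q^{u,\alpha},u,t)\Big)^T p,\qquad p(b)=0.$$ The cost functional is $\mathcal{L}^\alpha:\mathscr{C}^0([a,b],\mathbb{R}^m)\to\mathbb{R}$, $\mathcal{L}^\alpha(u)=\int_a^b L(q^{u,\alpha},u,t)\,dt$. A control $u$ is a critical point of $\mathcal{L}^\alpha$ if for every $\bar u\in\mathscr{C}^0([a,b],\mathbb{R}^m)$, $D\mathcal{L}^\alpha(u)(\bar u):=\lim_{\varepsilon\to0}\frac{\mathcal{L}^\alpha(u+\varepsilon\bar u)-\mathcal{L}^\alpha(u)}{\varepsilon}=0$. *)

theory Defs
  imports "HOL-Analysis.Analysis"
begin

section \<open>Differentiability classes on subsets\<close>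

text \<open>
  Derivatives are taken within \<open>S\<close>, hence one-sided at boundary points. The definitions are
  used for sets on which such a derivative is unique: \<open>{a..b}\<close> and \<open>UNIV \<times> UNIV \<times> {a..b}\<close>,
  with \<open>a < b\<close>.
\<close>

definition C1_on :: "'a::real_normed_vector set \<Rightarrow> ('a \<Rightarrow> 'b::real_normed_vector) \<Rightarrow> bool" where
  "C1_on S g \<longleftrightarrow> (\<exists>g' :: 'a \<Rightarrow> 'a \<Rightarrow>\<^sub>L 'b.
      (\<forall>z\<in>S. (g has_derivative blinfun_apply (g' z)) (at z within S)) \<and> continuous_on S g')"

definition C2_on :: "'a::real_normed_vector set \<Rightarrow> ('a \<Rightarrow> 'b::real_normed_vector) \<Rightarrow> bool" where
  "C2_on S g \<longleftrightarrow> (\<exists>g' :: 'a \<Rightarrow> 'a \<Rightarrow>\<^sub>L 'b.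
      (\<forall>z\<in>S. (g has_derivative blinfun_apply (g' z)) (at z within S)) \<and> C1_on S g')"

text \<open>For \<open>0 < \<alpha> \<le> 1\<close> the floor of \<open>\<alpha>\<close> is 0 or 1, so no other class is needed.\<close>

definition C_floor_on :: "real \<Rightarrow> real set \<Rightarrow> (real \<Rightarrow> 'a::real_normed_vector) \<Rightarrow> bool" where
  "C_floor_on \<alpha> S g \<longleftrightarrow> (if \<lfloor>\<alpha>\<rfloor> = 0 then continuous_on S g else C1_on S g)"

definition gradient :: "('a::real_inner \<Rightarrow> real) \<Rightarrow> 'a \<Rightarrow> 'a" where
  "gradient g x = (THE D. GDERIV g x :> D)"

section \<open>Fractional operators\<close>

text \<open>
  The integrals below already vanish at \<open>t = a\<close> and \<open>t = b\<close>, respectively, which is the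
  continuous extension by 0. The value of the kernel at its singularity is irrelevant for the
  integral.
\<close>

definition frac_int_left :: "real \<Rightarrow> real \<Rightarrow> (real \<Rightarrow> 'a::euclidean_space) \<Rightarrow> real \<Rightarrow> 'a" where
  "frac_int_left a \<beta> g t =
     (if \<beta> = 0 then g t
      else (1 / Gamma \<beta>) *\<^sub>R integral {a..t} (\<lambda>y. (t - y) powr (\<beta> - 1) *\<^sub>R g y))"

definition frac_int_right :: "real \<Rightarrow> real \<Rightarrow> (real \<Rightarrow> 'a::euclidean_space) \<Rightarrow> real \<Rightarrow> 'a" where
  "frac_int_right b \<beta> g t =
     (if \<beta> = 0 then g t
      else (1 / Gamma \<beta>) *\<^sub>R integral {t..b} (\<lambda>y. (y - t) powr (\<beta> - 1) *\<^sub>R g y))"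

text \<open>
  The Riemann--Liouville and Caputo derivatives are relations between a function, the value \<open>D\<close>
  and the point \<open>t\<close>, so that existence of the derivative is part of the assertion.
\<close>

definition has_RL_left ::
    "real \<Rightarrow> real \<Rightarrow> real \<Rightarrow> (real \<Rightarrow> 'a::euclidean_space) \<Rightarrow> 'a \<Rightarrow> real \<Rightarrow> bool" where
  "has_RL_left a b \<alpha> g D t \<longleftrightarrow>
     (frac_int_left a (1 - \<alpha>) g has_vector_derivative D) (at t within {a..b})"

definition has_RL_right ::
    "real \<Rightarrow> real \<Rightarrow> real \<Rightarrow> (real \<Rightarrow> 'a::euclidean_space) \<Rightarrow> 'a \<Rightarrow> real \<Rightarrow> bool" where
  "has_RL_right a b \<alpha> g D t \<longleftrightarrow>
     ((\<lambda>s. - frac_int_right b (1 - \<alpha>) g s) has_vector_derivative D) (at t within {a..b})"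

definition has_Caputo_left ::
    "real \<Rightarrow> real \<Rightarrow> real \<Rightarrow> (real \<Rightarrow> 'a::euclidean_space) \<Rightarrow> 'a \<Rightarrow> real \<Rightarrow> bool" where
  "has_Caputo_left a b \<alpha> g D t \<longleftrightarrow> has_RL_left a b \<alpha> (\<lambda>s. g s - g a) D t"

definition has_Caputo_right ::
    "real \<Rightarrow> real \<Rightarrow> real \<Rightarrow> (real \<Rightarrow> 'a::euclidean_space) \<Rightarrow> 'a \<Rightarrow> real \<Rightarrow> bool" where
  "has_Caputo_right a b \<alpha> g D t \<longleftrightarrow> has_RL_right a b \<alpha> (\<lambda>s. g s - g b) D t"

text \<open>
  Equality of the Caputo derivative of \<open>g\<close> with \<open>\<phi>\<close> as continuous functions on \<open>{a..b}\<close>: the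
  derivative is defined off one endpoint only, and continuity of \<open>\<phi>\<close> says that it extends
  continuously there with the value of \<open>\<phi>\<close>.
\<close>

definition Caputo_left_eq ::
    "real \<Rightarrow> real \<Rightarrow> real \<Rightarrow> (real \<Rightarrow> 'a::euclidean_space) \<Rightarrow> (real \<Rightarrow> 'a) \<Rightarrow> bool" where
  "Caputo_left_eq a b \<alpha> g \<phi> \<longleftrightarrow>
     continuous_on {a..b} \<phi> \<and> (\<forall>t\<in>{a<..b}. has_Caputo_left a b \<alpha> g (\<phi> t) t)"

definition Caputo_right_eq ::
    "real \<Rightarrow> real \<Rightarrow> real \<Rightarrow> (real \<Rightarrow> 'a::euclidean_space) \<Rightarrow> (real \<Rightarrow> 'a) \<Rightarrow> bool" where
  "Caputo_right_eq a b \<alpha> g \<phi> \<longleftrightarrow>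
     continuous_on {a..b} \<phi> \<and> (\<forall>t\<in>{a..<b}. has_Caputo_right a b \<alpha> g (\<phi> t) t)"

section \<open>The fractional control problem\<close>

definition Hamiltonian ::
    "('x \<Rightarrow> 'v \<Rightarrow> real \<Rightarrow> real) \<Rightarrow> ('x \<Rightarrow> 'v \<Rightarrow> real \<Rightarrow> 'x) \<Rightarrow>
     'x::real_inner \<Rightarrow> 'v \<Rightarrow> 'x \<Rightarrow> real \<Rightarrow> real" where
  "Hamiltonian L f x v w t = L x v t + w \<bullet> f x v t"

definition is_state ::
    "real \<Rightarrow> real \<Rightarrow> real \<Rightarrow> 'x \<Rightarrow> ('x \<Rightarrow> 'v \<Rightarrow> real \<Rightarrow> 'x) \<Rightarrow> (real \<Rightarrow> 'v) \<Rightarrow>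
     (real \<Rightarrow> 'x::euclidean_space) \<Rightarrow> bool" where
  "is_state a b \<alpha> A f u q \<longleftrightarrow>
     C_floor_on \<alpha> {a..b} q \<and> q a = A \<and>
     Caputo_left_eq a b \<alpha> q (\<lambda>t. f (q t) (u t) t)"

text \<open>
  Functions on \<open>{a..b}\<close> are represented by total functions, so uniqueness of the solution only
  makes sense after fixing the values outside the interval; this is the role of
  \<^const>\<open>extensional\<close>.
\<close>

definition state ::
    "real \<Rightarrow> real \<Rightarrow> real \<Rightarrow> 'x \<Rightarrow> ('x \<Rightarrow> 'v \<Rightarrow> real \<Rightarrow> 'x) \<Rightarrow> (real \<Rightarrow> 'v) \<Rightarrow>
     real \<Rightarrow> 'x::euclidean_space" where
  "state a b \<alpha> A f u = (THE q. q \<in> extensional {a..b} \<and> is_state a b \<alpha> A f u q)"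

definition is_adjoint ::
    "real \<Rightarrow> real \<Rightarrow> real \<Rightarrow> 'x \<Rightarrow> ('x \<Rightarrow> 'v \<Rightarrow> real \<Rightarrow> real) \<Rightarrow> ('x \<Rightarrow> 'v \<Rightarrow> real \<Rightarrow> 'x) \<Rightarrow>
     (real \<Rightarrow> 'v) \<Rightarrow> (real \<Rightarrow> 'x::euclidean_space) \<Rightarrow> bool" where
  "is_adjoint a b \<alpha> A L f u p \<longleftrightarrow>
     C_floor_on \<alpha> {a..b} p \<and> p b = 0 \<and>
     Caputo_right_eq a b \<alpha> p
       (\<lambda>t. gradient (\<lambda>x. Hamiltonian L f x (u t) (p t) t) (state a b \<alpha> A f u t))"

definition adjoint_state ::
    "real \<Rightarrow> real \<Rightarrow> real \<Rightarrow> 'x \<Rightarrow> ('x \<Rightarrow> 'v \<Rightarrow> real \<Rightarrow> real) \<Rightarrow> ('x \<Rightarrow> 'v \<Rightarrow> real \<Rightarrow> 'x) \<Rightarrow>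
     (real \<Rightarrow> 'v) \<Rightarrow> real \<Rightarrow> 'x::euclidean_space" where
  "adjoint_state a b \<alpha> A L f u =
     (THE p. p \<in> extensional {a..b} \<and> is_adjoint a b \<alpha> A L f u p)"

definition cost ::
    "real \<Rightarrow> real \<Rightarrow> real \<Rightarrow> 'x \<Rightarrow> ('x \<Rightarrow> 'v \<Rightarrow> real \<Rightarrow> real) \<Rightarrow>
     ('x::euclidean_space \<Rightarrow> 'v \<Rightarrow> real \<Rightarrow> 'x) \<Rightarrow> (real \<Rightarrow> 'v) \<Rightarrow> real" where
  "cost a b \<alpha> A L f u = integral {a..b} (\<lambda>t. L (state a b \<alpha> A f u t) (u t) t)"

definition critical_point ::
    "real \<Rightarrow> real \<Rightarrow> ((real \<Rightarrow> 'v::real_normed_vector) \<Rightarrow> real) \<Rightarrow> (real \<Rightarrow> 'v) \<Rightarrow> bool" where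
  "critical_point a b J u \<longleftrightarrow>
     (\<forall>w. continuous_on {a..b} w \<longrightarrow>
        ((\<lambda>\<epsilon>. (J (\<lambda>t. u t + \<epsilon> *\<^sub>R w t) - J u) / \<epsilon>) \<longlongrightarrow> 0) (at 0))"

definition solves_stationary ::
    "real \<Rightarrow> real \<Rightarrow> ('x \<Rightarrow> 'v \<Rightarrow> 'x \<Rightarrow> real \<Rightarrow> real) \<Rightarrow>
     (real \<Rightarrow> 'x) \<Rightarrow> (real \<Rightarrow> 'v::real_inner) \<Rightarrow> (real \<Rightarrow> 'x) \<Rightarrow> bool" where
  "solves_stationary a b H q u p \<longleftrightarrow>
     (\<forall>t\<in>{a..b}. gradient (\<lambda>v. H (q t) v (p t) t) (u t) = 0)"

end

theory Submission
  imports Defs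
begin

text \<open>
  Write \<open>q\<close> and \<open>p\<close> for the state and the adjoint state of \<open>u\<close>. The heart of the matter is the formula

    \<open>D J(u)(w) = \<integral> \<partial>H/\<partial>v(q, u, p, t) \<bullet> w dt\<close>

  for the cost \<open>J\<close> (lemma \<open>cost_has_derivative\<close>). It implies the theorem because \<open>\<partial>H/\<partial>v\<close> along the
  trajectory is continuous, so that it may be chosen as the perturbation \<open>w\<close>.

  To obtain the formula, let \<open>\<Delta>\<close> be the increment of the state and \<open>\<psi>\<close> that of \<open>f\<close> when \<open>u\<close> is
  replaced by \<open>u + \<epsilon> w\<close>. The Caputo equations are equivalent to the integral equations
  \<open>\<Delta> = I\<^sub>- \<psi>\<close> and \<open>p = I\<^sub>+ \<chi>\<close> with \<open>\<chi> = \<partial>H/\<partial>x\<close>, where \<open>I\<^sub>-\<close> and \<open>I\<^sub>+\<close> are the left and right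
  fractional integrals of order \<open>\<alpha>\<close> (lemmas \<open>Caputo_left_problem_iff\<close> and
  \<open>Caputo_right_problem_iff\<close>). As these two operators are adjoint to each other
  (\<open>integral_causal_conv_by_parts\<close>),

    \<open>\<integral> \<chi> \<bullet> \<Delta> = \<integral> \<chi> \<bullet> I\<^sub>- \<psi> = \<integral> I\<^sub>+ \<chi> \<bullet> \<psi> = \<integral> p \<bullet> \<psi>\<close>.

  Inserting the first-order expansions of \<open>f\<close> and \<open>L\<close>, all terms containing \<open>\<Delta>\<close> cancel and
  \<open>\<epsilon> \<integral> \<partial>H/\<partial>v \<bullet> w\<close> remains, up to remainders that are \<open>o(\<epsilon>)\<close> since \<open>\<Delta> = O(\<epsilon>)\<close> uniformly
  (\<open>state_Lipschitz_in_control\<close>). Working with the increment itself avoids the linearized state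
  equation and the differentiation of the state with respect to the control.

  The analytic foundation is a theory of Volterra equations \<open>x = A + K * F(x)\<close> with a nonnegative
  integrable kernel supported on the positive half-line. In the norm weighted by \<open>exp (- \<mu> t)\<close> the
  convolution has operator norm at most the Laplace transform of \<open>K\<close> at \<open>\<mu>\<close>, which tends to 0 as
  \<open>\<mu>\<close> grows. This gives global existence, uniqueness and a Gronwall inequality. The
  equivalence of differential and integral equations rests on the semigroup law of fractional
  integrals, that is, on Fubini's theorem and the Beta integral. Right-sided statements are
  reduced to left-sided ones by the reflection \<open>t \<mapsto> a + b - t\<close>.
\<close>

section \<open>Convolution with a causal integrable kernel\<close>

definition causal_conv ::
    "(real \<Rightarrow> real) \<Rightarrow> real \<Rightarrow> real \<Rightarrow> (real \<Rightarrow> 'a::euclidean_space) \<Rightarrow> real \<Rightarrow> 'a" where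
  "causal_conv K a b h t = (LINT y:{a..b}|lborel. K (t - y) *\<^sub>R h y)"

definition anticausal_conv ::
    "(real \<Rightarrow> real) \<Rightarrow> real \<Rightarrow> real \<Rightarrow> (real \<Rightarrow> 'a::euclidean_space) \<Rightarrow> real \<Rightarrow> 'a" where
  "anticausal_conv K a b h t = (LINT y:{a..b}|lborel. K (y - t) *\<^sub>R h y)"

lemma causal_conv_cong:
  assumes "\<And>y. y \<in> {a..b} \<Longrightarrow> g y = h y"
  shows "causal_conv K a b g t = causal_conv K a b h t"
  unfolding causal_conv_def set_lebesgue_integral_def
  by (rule Bochner_Integration.integral_cong) (auto simp: indicator_def assms)

lemma anticausal_conv_cong:
  assumes "\<And>y. y \<in> {a..b} \<Longrightarrow> g y = h y"
  shows "anticausal_conv K a b g t = anticausal_conv K a b h t"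
  unfolding anticausal_conv_def set_lebesgue_integral_def
  by (rule Bochner_Integration.integral_cong) (auto simp: indicator_def assms)

text \<open>
  The time reversal \<open>t \<mapsto> a + b - t\<close> exchanges the two convolutions; existence, uniqueness and
  continuity for the right-sided equations are reduced to the left-sided ones in this way.
\<close>

lemma anticausal_conv_reflect:
  "anticausal_conv K a b h t = causal_conv K a b (\<lambda>s. h (a + b - s)) (a + b - t)"
  unfolding causal_conv_def anticausal_conv_def set_lebesgue_integral_def
  by (subst lborel_integral_real_affine[where c = "-1" and t = "a + b"])
     (auto intro!: Bochner_Integration.integral_cong simp: indicator_def algebra_simps)

text \<open>
  Extended by 0, a continuous function on \<open>{a..b}\<close> becomes a bounded Borel function on the line, so
  that the integrals over \<open>{a..b}\<close> turn into honest convolutions with an integrable kernel.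
\<close>

lemma zero_extension_measurable_bounded:
  fixes h :: "real \<Rightarrow> 'a::euclidean_space"
  assumes "continuous_on {a..b} h"
  shows "(\<lambda>y. indicator {a..b} y *\<^sub>R h y) \<in> borel_measurable borel"
    and "\<exists>B. \<forall>y. norm (indicator {a..b} y *\<^sub>R h y) \<le> B"
proof -
  show "(\<lambda>y. indicator {a..b} y *\<^sub>R h y) \<in> borel_measurable borel"
    by (intro borel_measurable_continuous_on_indicator assms) auto
  have "bounded (h ` {a..b})"
    using assms by (intro compact_imp_bounded compact_continuous_image) auto
  then obtain B where B: "\<And>y. y \<in> {a..b} \<Longrightarrow> norm (h y) \<le> B" "0 < B"
    unfolding bounded_pos by blast
  have "norm (indicator {a..b} y *\<^sub>R h y) \<le> B" for y
    using B by (cases "y \<in> {a..b}") (auto simp: indicator_def)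
  then show "\<exists>B. \<forall>y. norm (indicator {a..b} y *\<^sub>R h y) \<le> B" by blast
qed

text \<open>
  The properties through which the solution theory sees the weakly singular kernel
  \<open>s powr (\<beta> - 1) / Gamma \<beta>\<close>.
\<close>

locale causal_kernel =
  fixes K :: "real \<Rightarrow> real"
  assumes integrable_kernel: "integrable lborel K"
    and kernel_nonneg: "0 \<le> K s"
    and kernel_causal: "s \<le> 0 \<Longrightarrow> K s = 0"
begin

lemma kernel_measurable [measurable]: "K \<in> borel_measurable borel"
  using borel_measurable_integrable[OF integrable_kernel] by simp

lemma integrable_reflected_kernel: "integrable lborel (\<lambda>y. K (t - y))"
  using lborel_integrable_real_affine_iff[of "-1" K t] integrable_kernel by simp

lemma integral_reflected_kernel: "(\<integral>y. K (t - y) \<partial>lborel) = (\<integral>s. K s \<partial>lborel)"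
  using lborel_integral_real_affine[of "-1" K t] by simp

lemma integrable_kernel_mult:
  fixes h :: "real \<Rightarrow> 'a::euclidean_space"
  assumes [measurable]: "h \<in> borel_measurable borel" and B: "\<And>y. norm (h y) \<le> B"
  shows "integrable lborel (\<lambda>y. K (t - y) *\<^sub>R h y)"
proof (rule Bochner_Integration.integrable_bound)
  show "integrable lborel (\<lambda>y. B * K (t - y))"
    using integrable_reflected_kernel by simp
  show "(\<lambda>y. K (t - y) *\<^sub>R h y) \<in> borel_measurable lborel" by measurable
  show "AE y in lborel. norm (K (t - y) *\<^sub>R h y) \<le> norm (B * K (t - y))"
  proof (rule AE_I2)
    fix y
    have "K (t - y) * norm (h y) \<le> K (t - y) * B"
      by (intro mult_left_mono B kernel_nonneg)
    then show "norm (K (t - y) *\<^sub>R h y) \<le> norm (B * K (t - y))"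
      using kernel_nonneg[of "t - y"] order_trans[OF norm_ge_zero B[of y]] by (simp add: mult.commute)
  qed
qed

lemma set_integrable_kernel:
  fixes h :: "real \<Rightarrow> 'a::euclidean_space"
  assumes "continuous_on {a..b} h"
  shows "set_integrable lborel {a..b} (\<lambda>y. K (t - y) *\<^sub>R h y)"
proof -
  obtain B where "\<And>y. norm (indicator {a..b} y *\<^sub>R h y) \<le> B"
    using zero_extension_measurable_bounded(2)[OF assms] by blast
  from integrable_kernel_mult[OF zero_extension_measurable_bounded(1)[OF assms] this, of t]
  show ?thesis by (simp add: set_integrable_def mult.commute)
qed

text \<open>
  Both the semigroup law (with scalar multiplication for \<open>prod\<close>) and the fractional integration by
  parts (with the inner product) are instances of this exchange of integrals. The function \<open>g\<close> is only
  assumed integrable, since for the semigroup law it is itself a singular kernel. The double integral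
  converges because \<open>\<integral>\<integral> \<bar>K (t - y)\<bar> * norm (g t)\<close> is the product of the \<open>L\<^sup>1\<close> norms and \<open>h\<close> is bounded.
\<close>

lemma Fubini_kernel:
  fixes prod :: "'p::euclidean_space \<Rightarrow> 'x::euclidean_space \<Rightarrow> 'z::euclidean_space"
  assumes prod: "bounded_bilinear prod"
    and g: "integrable lborel g"
    and h[measurable]: "h \<in> borel_measurable borel" and B: "\<And>y. norm (h y) \<le> B"
  shows "(\<integral>t. prod (g t) (\<integral>y. K (t - y) *\<^sub>R h y \<partial>lborel) \<partial>lborel) =
         (\<integral>y. prod (\<integral>t. K (t - y) *\<^sub>R g t \<partial>lborel) (h y) \<partial>lborel)"
proof -
  interpret prod: bounded_bilinear prod by (rule prod)
  have [measurable]: "g \<in> borel_measurable borel" using borel_measurable_integrable[OF g] by simp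
  have B0: "0 \<le> B" using order_trans[OF norm_ge_zero B] .
  obtain C where C: "0 < C" "\<And>x y. norm (prod x y) \<le> norm x * norm y * C"
    using prod.pos_bounded by blast
  have J: "integrable (lborel \<Otimes>\<^sub>M lborel) (\<lambda>(t, y). K (t - y) *\<^sub>R g t)"
  proof (rule lborel_pair.Fubini_integrable)
    show "(\<lambda>(t, y). K (t - y) *\<^sub>R g t) \<in> borel_measurable (lborel \<Otimes>\<^sub>M lborel)"
      by measurable
    have "(\<lambda>t. \<integral>y. norm (case (t, y) of (t, y) \<Rightarrow> K (t - y) *\<^sub>R g t) \<partial>lborel) =
          (\<lambda>t. (\<integral>s. K s \<partial>lborel) * norm (g t))"
      by (simp add: kernel_nonneg integral_reflected_kernel)
    then show "integrable lborel
        (\<lambda>t. \<integral>y. norm (case (t, y) of (t, y) \<Rightarrow> K (t - y) *\<^sub>R g t) \<partial>lborel)"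
      using integrable_norm[OF g] by simp
    show "AE t in lborel. integrable lborel (\<lambda>y. case (t, y) of (t, y) \<Rightarrow> K (t - y) *\<^sub>R g t)"
      using integrable_reflected_kernel by simp
  qed
  have [measurable]: "(\<lambda>p. prod (g (fst p)) (h (snd p))) \<in> borel_measurable (lborel \<Otimes>\<^sub>M lborel)"
    by (rule borel_measurable_continuous_Pair)
       (auto intro!: prod.continuous_on continuous_on_fst continuous_on_snd continuous_on_id)
  have I: "integrable (lborel \<Otimes>\<^sub>M lborel) (\<lambda>(t, y). K (t - y) *\<^sub>R prod (g t) (h y))"
  proof (rule Bochner_Integration.integrable_bound)
    show "integrable (lborel \<Otimes>\<^sub>M lborel) (\<lambda>p. (B * C) * norm (case p of (t, y) \<Rightarrow> K (t - y) *\<^sub>R g t))"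
      using integrable_norm[OF J] by (intro integrable_mult_right) auto
    show "(\<lambda>(t, y). K (t - y) *\<^sub>R prod (g t) (h y)) \<in> borel_measurable (lborel \<Otimes>\<^sub>M lborel)"
      unfolding split_beta by measurable
    show "AE p in lborel \<Otimes>\<^sub>M lborel. norm (case p of (t, y) \<Rightarrow> K (t - y) *\<^sub>R prod (g t) (h y)) \<le>
        norm ((B * C) * norm (case p of (t, y) \<Rightarrow> K (t - y) *\<^sub>R g t))"
    proof (rule AE_I2, clarify)
      fix t y
      have "norm (prod (g t) (h y)) \<le> norm (g t) * B * C"
        using C(2)[of "g t" "h y"] mult_mono[OF mult_left_mono[OF B, of "norm (g t)" y] order_refl[of C]] C(1) B0
        by (smt (verit) mult_nonneg_nonneg norm_ge_zero)
      then have "K (t - y) * norm (prod (g t) (h y)) \<le> K (t - y) * (norm (g t) * B * C)"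
        by (rule mult_left_mono) (rule kernel_nonneg)
      then show "norm (K (t - y) *\<^sub>R prod (g t) (h y)) \<le> norm ((B * C) * norm (K (t - y) *\<^sub>R g t))"
        using kernel_nonneg[of "t - y"] C(1) B0 by (simp add: abs_mult ac_simps)
    qed
  qed
  have "(\<integral>t. prod (g t) (\<integral>y. K (t - y) *\<^sub>R h y \<partial>lborel) \<partial>lborel) =
        (\<integral>t. (\<integral>y. K (t - y) *\<^sub>R prod (g t) (h y) \<partial>lborel) \<partial>lborel)"
  proof (rule Bochner_Integration.integral_cong[OF refl])
    fix t
    show "prod (g t) (\<integral>y. K (t - y) *\<^sub>R h y \<partial>lborel) =
          (\<integral>y. K (t - y) *\<^sub>R prod (g t) (h y) \<partial>lborel)"
      by (subst integral_bounded_linear[OF prod.bounded_linear_right integrable_kernel_mult[OF h B], symmetric])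
         (simp add: prod.scaleR_right)
  qed
  also have "\<dots> = (\<integral>y. (\<integral>t. K (t - y) *\<^sub>R prod (g t) (h y) \<partial>lborel) \<partial>lborel)"
    by (rule lborel_pair.Fubini_integral[OF I, symmetric])
  \<comment> \<open>For two integrable functions the convolution integral exists only almost everywhere.\<close>
  also have "\<dots> = (\<integral>y. prod (\<integral>t. K (t - y) *\<^sub>R g t \<partial>lborel) (h y) \<partial>lborel)"
  proof (rule integral_cong_AE)
    have [measurable]: "(\<lambda>y. \<integral>t. K (t - y) *\<^sub>R g t \<partial>lborel) \<in> borel_measurable borel"
      using borel_measurable_integrable[OF lborel_pair.integrable_snd[OF J]] by simp
    show "(\<lambda>y. prod (\<integral>t. K (t - y) *\<^sub>R g t \<partial>lborel) (h y)) \<in> borel_measurable lborel"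
      by (rule borel_measurable_continuous_Pair)
       (auto intro!: prod.continuous_on continuous_on_fst continuous_on_snd continuous_on_id)
    show "(\<lambda>y. \<integral>t. K (t - y) *\<^sub>R prod (g t) (h y) \<partial>lborel) \<in> borel_measurable lborel"
      by (rule borel_measurable_integrable[OF lborel_pair.integrable_snd[OF I]])
    show "AE y in lborel. (\<integral>t. K (t - y) *\<^sub>R prod (g t) (h y) \<partial>lborel) =
        prod (\<integral>t. K (t - y) *\<^sub>R g t \<partial>lborel) (h y)"
      using lborel_pair.AE_integrable_snd[OF J]
    proof eventually_elim
      fix y assume "integrable lborel (\<lambda>t. K (t - y) *\<^sub>R g t)"
      from integral_bounded_linear[OF prod.bounded_linear_left this, of "h y"]
      show "(\<integral>t. K (t - y) *\<^sub>R prod (g t) (h y) \<partial>lborel) =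
        prod (\<integral>t. K (t - y) *\<^sub>R g t \<partial>lborel) (h y)"
        by (simp add: prod.scaleR_left)
    qed
  qed
  finally show ?thesis .
qed

lemma causal_conv_shift:
  "causal_conv K a b h t = (\<integral>s. K s *\<^sub>R (indicator {a..b} (t - s) *\<^sub>R h (t - s)) \<partial>lborel)"
  unfolding causal_conv_def set_lebesgue_integral_def
  by (subst lborel_integral_real_affine[where c = "-1" and t = t])
     (auto intro!: Bochner_Integration.integral_cong simp: mult.commute)

text \<open>
  After the substitution that moves the variable \<open>t\<close> from the kernel to \<open>h\<close>, dominated convergence
  applies: the zero extension of \<open>h\<close> jumps at \<open>a\<close> and \<open>b\<close> only, which affects just two values
  of \<open>s\<close>.
\<close>

lemma continuous_on_causal_conv:
  fixes h :: "real \<Rightarrow> 'a::euclidean_space"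
  assumes h: "continuous_on {a..b} h"
  shows "continuous_on S (causal_conv K a b h)"
proof -
  let ?h = "\<lambda>y. indicator {a..b} y *\<^sub>R h y"
  have [measurable]: "?h \<in> borel_measurable borel"
    by (rule zero_extension_measurable_bounded(1)[OF h])
  obtain B where B: "\<And>y. norm (?h y) \<le> B"
    using zero_extension_measurable_bounded(2)[OF h] by blast
  have cont: "isCont ?h y" if ab: "y \<noteq> a" "y \<noteq> b" for y
  proof -
    consider "y < a" | "y > b" | "y \<in> {a<..<b}" using ab by fastforce
    then show ?thesis
    proof cases
      case 1
      have "continuous_on {..<a} ?h"
        by (rule continuous_on_eq[of _ "\<lambda>_. 0"]) auto
      then show ?thesis using 1 by (simp add: continuous_on_eq_continuous_at)
    next
      case 2
      have "continuous_on {b<..} ?h"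
        by (rule continuous_on_eq[of _ "\<lambda>_. 0"]) auto
      then show ?thesis using 2 by (simp add: continuous_on_eq_continuous_at)
    next
      case 3
      have "continuous_on {a<..<b} h" by (rule continuous_on_subset[OF h]) auto
      then have "continuous_on {a<..<b} ?h"
        by (rule continuous_on_eq) auto
      then show ?thesis using 3 by (simp add: continuous_on_eq_continuous_at)
    qed
  qed
  have "isCont (causal_conv K a b h) t" for t
    unfolding continuous_at_sequentially
  proof (intro allI impI)
    fix x :: "nat \<Rightarrow> real" assume x: "x \<longlonglongrightarrow> t"
    show "(causal_conv K a b h \<circ> x) \<longlonglongrightarrow> causal_conv K a b h t"
      unfolding o_def causal_conv_shift
    proof (rule integral_dominated_convergence[where w = "\<lambda>s. B * K s"])
      show "(\<lambda>s. K s *\<^sub>R ?h (t - s)) \<in> borel_measurable lborel" by measurable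
      show "(\<lambda>s. K s *\<^sub>R ?h (x i - s)) \<in> borel_measurable lborel" for i by measurable
      show "integrable lborel (\<lambda>s. B * K s)" using integrable_kernel by simp
      show "AE s in lborel. norm (K s *\<^sub>R ?h (x i - s)) \<le> B * K s" for i
      proof (rule AE_I2)
        fix s
        show "norm (K s *\<^sub>R ?h (x i - s)) \<le> B * K s"
          using mult_left_mono[OF B kernel_nonneg[of s], of "x i - s"] kernel_nonneg[of s]
          by (simp add: ac_simps)
      qed
      have "AE s in lborel. s \<noteq> t - a" "AE s in lborel. s \<noteq> t - b"
        by (rule AE_lborel_singleton)+
      then show "AE s in lborel. (\<lambda>i. K s *\<^sub>R ?h (x i - s)) \<longlonglongrightarrow> K s *\<^sub>R ?h (t - s)"
      proof eventually_elim
        fix s assume "s \<noteq> t - a" "s \<noteq> t - b"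
        then have "isCont ?h (t - s)" by (intro cont) auto
        moreover have "(\<lambda>i. x i - s) \<longlonglongrightarrow> t - s" by (intro tendsto_intros x)
        ultimately have "(\<lambda>i. ?h (x i - s)) \<longlonglongrightarrow> ?h (t - s)"
          by (rule isCont_tendsto_compose)
        then show "(\<lambda>i. K s *\<^sub>R ?h (x i - s)) \<longlonglongrightarrow> K s *\<^sub>R ?h (t - s)"
          by (rule tendsto_scaleR[OF tendsto_const])
      qed
    qed
  qed
  then show ?thesis by (simp add: continuous_at_imp_continuous_on)
qed

lemma causal_conv_diff:
  fixes g h :: "real \<Rightarrow> 'a::euclidean_space"
  assumes "continuous_on {a..b} g" "continuous_on {a..b} h"
  shows "causal_conv K a b (\<lambda>y. g y - h y) t = causal_conv K a b g t - causal_conv K a b h t"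
  unfolding causal_conv_def scaleR_diff_right
  by (intro set_integral_diff set_integrable_kernel assms)

lemma norm_kernel_exp_le:
  assumes "0 \<le> \<mu>"
  shows "norm (K s * exp (- \<mu> * s)) \<le> K s"
proof (cases "s \<le> 0")
  case True
  then show ?thesis by (simp add: kernel_causal)
next
  case False
  then have "exp (- \<mu> * s) \<le> 1" using assms by simp
  then show ?thesis
    using kernel_nonneg[of s] mult_left_mono[of "exp (- \<mu> * s)" 1 "K s"] by (simp add: abs_mult)
qed

lemma integrable_kernel_exp:
  assumes "0 \<le> \<mu>"
  shows "integrable lborel (\<lambda>s. K s * exp (- \<mu> * s))"
proof (rule Bochner_Integration.integrable_bound[OF integrable_kernel])
  show "AE s in lborel. norm (K s * exp (- \<mu> * s)) \<le> norm (K s)"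
    by (intro AE_I2 order_trans[OF norm_kernel_exp_le[OF assms]]) simp
qed measurable

text \<open>
  The Laplace transform of an integrable function tends to 0. This is what makes the
  Volterra operator a contraction in a sufficiently heavily weighted norm.
\<close>

lemma Laplace_transform_kernel_small:
  assumes "0 < (e::real)"
  shows "\<exists>\<mu>\<ge>0. (\<integral>s. K s * exp (- \<mu> * s) \<partial>lborel) \<le> e"
proof -
  have "(\<lambda>n. \<integral>s. K s * exp (- real n * s) \<partial>lborel) \<longlonglongrightarrow> (\<integral>s. 0 \<partial>(lborel::real measure))"
  proof (rule integral_dominated_convergence[where w = K])
    show "AE s in lborel. norm (K s * exp (- real n * s)) \<le> K s" for n
      by (intro AE_I2 norm_kernel_exp_le) simp
    show "AE s in lborel. (\<lambda>n. K s * exp (- real n * s)) \<longlonglongrightarrow> 0"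
    proof (rule AE_I2)
      fix s
      show "(\<lambda>n. K s * exp (- real n * s)) \<longlonglongrightarrow> 0"
      proof (cases "s \<le> 0")
        case True then show ?thesis by (simp add: kernel_causal)
      next
        case False
        then have "exp (- s) < 1" by simp
        then have "(\<lambda>n. K s * exp (- s) ^ n) \<longlonglongrightarrow> K s * 0"
          by (intro tendsto_intros LIMSEQ_power_zero) auto
        then show ?thesis by (simp flip: exp_of_nat_mult)
      qed
    qed
  qed (use integrable_kernel in auto)
  then have "eventually (\<lambda>n. (\<integral>s. K s * exp (- real n * s) \<partial>lborel) < e) sequentially"
    using assms by (auto dest: order_tendstoD)
  then obtain n where "(\<integral>s. K s * exp (- real n * s) \<partial>lborel) < e"
    by (auto simp: eventually_sequentially)
  then show ?thesis by (intro exI[of _ "real n"]) auto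
qed

text \<open>
  In the norm weighted by \<open>exp (- \<mu> * t)\<close>, the convolution operator is bounded by the Laplace transform
  of the kernel at \<open>\<mu>\<close>.
\<close>

lemma norm_causal_conv_le_exp:
  fixes h :: "real \<Rightarrow> 'a::euclidean_space"
  assumes h: "continuous_on {a..b} h" and "0 \<le> \<mu>" "0 \<le> c"
    and c: "\<And>y. y \<in> {a..b} \<Longrightarrow> norm (h y) \<le> c * exp (\<mu> * y)"
  shows "norm (causal_conv K a b h t) \<le> c * (\<integral>s. K s * exp (- \<mu> * s) \<partial>lborel) * exp (\<mu> * t)"
proof -
  let ?h = "\<lambda>y. indicator {a..b} y *\<^sub>R h y"
  have pw: "norm (K s *\<^sub>R ?h (t - s)) \<le> c * exp (\<mu> * t) * (K s * exp (- \<mu> * s))" for s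
  proof (cases "t - s \<in> {a..b}")
    case True
    have "K s * norm (h (t - s)) \<le> K s * (c * exp (\<mu> * (t - s)))"
      by (intro mult_left_mono c True kernel_nonneg)
    also have "\<dots> = c * exp (\<mu> * t) * (K s * exp (- \<mu> * s))"
      by (simp add: right_diff_distrib exp_diff exp_minus divide_simps)
    finally show ?thesis using True kernel_nonneg[of s] by simp
  next
    case False
    then show ?thesis using kernel_nonneg[of s] assms(3) by simp
  qed
  have "norm (causal_conv K a b h t) \<le> (\<integral>s. norm (K s *\<^sub>R ?h (t - s)) \<partial>lborel)"
    unfolding causal_conv_shift by (rule integral_norm_bound)
  also have "\<dots> \<le> (\<integral>s. c * exp (\<mu> * t) * (K s * exp (- \<mu> * s)) \<partial>lborel)"
  proof (rule integral_mono_AE')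
    show "integrable lborel (\<lambda>s. c * exp (\<mu> * t) * (K s * exp (- \<mu> * s)))"
      using integrable_kernel_exp[OF assms(2)] by simp
  qed (use pw in \<open>auto intro!: AE_I2 mult_nonneg_nonneg kernel_nonneg assms(3)\<close>)
  also have "\<dots> = c * exp (\<mu> * t) * (\<integral>s. K s * exp (- \<mu> * s) \<partial>lborel)"
    by (rule integral_mult_right_zero)
  finally show ?thesis by (simp add: ac_simps)
qed

end

section \<open>Volterra integral equations\<close>

context causal_kernel
begin

text \<open>
  A Gronwall inequality for the weakly singular kernel. In the weighted norm of \<open>\<Delta>\<close>, the contribution
  \<open>M * norm (\<Delta> t)\<close> is absorbed by the left-hand side once \<open>\<mu>\<close> is large. The constant depends on the
  kernel, the interval and \<open>M\<close> only, which is what makes it usable for a whole family of perturbations.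
\<close>

lemma causal_conv_Gronwall:
  assumes "a \<le> b" "0 \<le> M"
  shows "\<exists>C\<ge>0. \<forall>\<Delta> \<psi> :: real \<Rightarrow> 'a::euclidean_space. \<forall>\<eta>\<ge>0.
    continuous_on {a..b} \<Delta> \<longrightarrow> continuous_on {a..b} \<psi> \<longrightarrow>
    (\<forall>t\<in>{a..b}. \<Delta> t = causal_conv K a b \<psi> t) \<longrightarrow>
    (\<forall>t\<in>{a..b}. norm (\<psi> t) \<le> M * norm (\<Delta> t) + \<eta>) \<longrightarrow>
    (\<forall>t\<in>{a..b}. norm (\<Delta> t) \<le> C * \<eta>)"
proof -
  \<comment> \<open>The bound on the operator norm; both \<open>M * l\<close> and \<open>l\<close> must not exceed one half.\<close>
  define l where "l = 1 / (2 * (M + 1))"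
  have l: "0 < l" "M * l \<le> 1 / 2" "l \<le> 1 / 2" using assms(2) by (auto simp: l_def field_simps)
  obtain \<mu> where \<mu>: "0 \<le> \<mu>" "(\<integral>s. K s * exp (- \<mu> * s) \<partial>lborel) \<le> l"
    using Laplace_transform_kernel_small[OF l(1)] by blast
  show ?thesis
  proof (intro exI[of _ "exp (\<mu> * (b - a))"] conjI allI impI ballI)
    fix \<Delta> \<psi> :: "real \<Rightarrow> 'a" and \<eta> t :: real
    assume \<eta>: "0 \<le> \<eta>" and \<Delta>: "continuous_on {a..b} \<Delta>" and \<psi>: "continuous_on {a..b} \<psi>"
      and eq: "\<forall>t\<in>{a..b}. \<Delta> t = causal_conv K a b \<psi> t"
      and le: "\<forall>t\<in>{a..b}. norm (\<psi> t) \<le> M * norm (\<Delta> t) + \<eta>"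
      and t: "t \<in> {a..b}"
    have "continuous_on {a..b} (\<lambda>t. exp (- \<mu> * t) * norm (\<Delta> t))"
      by (intro continuous_intros \<Delta>)
    then obtain r where r: "r \<in> {a..b}"
      and max: "\<And>s. s \<in> {a..b} \<Longrightarrow> exp (- \<mu> * s) * norm (\<Delta> s) \<le> exp (- \<mu> * r) * norm (\<Delta> r)"
      using continuous_attains_sup[of "{a..b}" "\<lambda>t. exp (- \<mu> * t) * norm (\<Delta> t)"] assms(1) by auto
    define N where "N = exp (- \<mu> * r) * norm (\<Delta> r)"
    have N0: "0 \<le> N" by (simp add: N_def)
    have N: "norm (\<Delta> s) \<le> N * exp (\<mu> * s)" if "s \<in> {a..b}" for s
      using max[OF that] by (simp add: N_def exp_minus field_simps)
    define c where "c = M * N + \<eta> * exp (- \<mu> * a)"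
    have c0: "0 \<le> c" using \<eta> N0 assms(2) by (simp add: c_def)
    have "norm (\<psi> y) \<le> c * exp (\<mu> * y)" if y: "y \<in> {a..b}" for y
    proof -
      have "1 \<le> exp (- \<mu> * a) * exp (\<mu> * y)"
        using y \<mu>(1) by (simp add: mult_left_mono flip: exp_add)
      then have "\<eta> * 1 \<le> \<eta> * (exp (- \<mu> * a) * exp (\<mu> * y))"
        by (rule mult_left_mono) (rule \<eta>)
      moreover have "M * norm (\<Delta> y) \<le> M * (N * exp (\<mu> * y))"
        by (rule mult_left_mono[OF N[OF y] assms(2)])
      ultimately show ?thesis
        using le y by (force simp: c_def algebra_simps)
    qed
    from norm_causal_conv_le_exp[OF \<psi> \<mu>(1) c0 this, of r]
    have "norm (\<Delta> r) \<le> c * (\<integral>s. K s * exp (- \<mu> * s) \<partial>lborel) * exp (\<mu> * r)"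
      using eq r by simp
    also have "\<dots> \<le> c * l * exp (\<mu> * r)"
      using \<mu>(2) c0 by (intro mult_right_mono mult_left_mono) auto
    finally have "N \<le> c * l"
      by (simp add: N_def exp_minus field_simps)
    also have "c * l = (M * l) * N + l * (\<eta> * exp (- \<mu> * a))" by (simp add: c_def algebra_simps)
    also have "\<dots> \<le> 1 / 2 * N + 1 / 2 * (\<eta> * exp (- \<mu> * a))"
      using l \<eta> N0 by (intro add_mono mult_right_mono) auto
    finally have "N \<le> \<eta> * exp (- \<mu> * a)" by simp
    then have "N * exp (\<mu> * t) \<le> \<eta> * exp (- \<mu> * a) * exp (\<mu> * t)" by simp
    also have "\<dots> = exp (\<mu> * (t - a)) * \<eta>" by (simp add: algebra_simps flip: exp_add)
    also have "\<dots> \<le> exp (\<mu> * (b - a)) * \<eta>"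
      using t \<mu>(1) \<eta> by (intro mult_right_mono) (auto intro: mult_left_mono)
    finally show "norm (\<Delta> t) \<le> exp (\<mu> * (b - a)) * \<eta>" using N[OF t] by simp
  qed auto
qed

text \<open>
  Banach's fixed point theorem in the space of bounded continuous functions, for the unknown
  \<open>y t = exp (- \<mu> * t) *\<^sub>R x t\<close>. Rescaling the unknown makes the plain supremum norm of \<open>y\<close> the
  weighted norm of \<open>x\<close>, so the contraction property holds on all of \<open>{a..b}\<close> at once and the solution is
  global. Composing with the projection \<open>\<tau>\<close> onto \<open>{a..b}\<close> yields functions on the whole line.
\<close>

lemma Volterra_exists:
  fixes F :: "real \<Rightarrow> 'a \<Rightarrow> 'a::euclidean_space"
  assumes "a \<le> b" "0 \<le> M"
    and Fc: "\<And>x. continuous_on {a..b} x \<Longrightarrow> continuous_on {a..b} (\<lambda>t. F t (x t))"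
    and Lip: "\<And>t x y. t \<in> {a..b} \<Longrightarrow> norm (F t x - F t y) \<le> M * norm (x - y)"
  shows "\<exists>x. continuous_on {a..b} x \<and>
             (\<forall>t\<in>{a..b}. x t = A + causal_conv K a b (\<lambda>s. F s (x s)) t)"
proof -
  define l where "l = 1 / (2 * (M + 1))"
  have l: "0 < l" "M * l \<le> 1 / 2" using assms(2) by (auto simp: l_def field_simps)
  obtain \<mu> where \<mu>: "0 \<le> \<mu>" "(\<integral>s. K s * exp (- \<mu> * s) \<partial>lborel) \<le> l"
    using Laplace_transform_kernel_small[OF l(1)] by blast
  define \<tau> where "\<tau> = (\<lambda>t. max a (min b t))"
  have \<tau>: "\<tau> t \<in> {a..b}" for t using assms(1) by (auto simp: \<tau>_def)
  have \<tau>c: "continuous_on UNIV \<tau>" unfolding \<tau>_def by (intro continuous_intros)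
  define G where "G = (\<lambda>(y :: real \<Rightarrow>\<^sub>C 'a) t.
    exp (- \<mu> * t) *\<^sub>R (A + causal_conv K a b (\<lambda>s. F s (exp (\<mu> * s) *\<^sub>R apply_bcontfun y s)) t))"
  have Fy: "continuous_on {a..b} (\<lambda>s. F s (exp (\<mu> * s) *\<^sub>R apply_bcontfun y s))" for y
    by (intro Fc continuous_intros) auto
  have Gc: "continuous_on {a..b} (G y)" for y
    unfolding G_def by (intro continuous_intros continuous_on_causal_conv Fy)
  have "(\<lambda>t. G y (\<tau> t)) \<in> bcontfun" for y
  proof -
    have "continuous_on UNIV (\<lambda>t. G y (\<tau> t))"
      by (rule continuous_on_compose2[OF Gc \<tau>c]) (use \<tau> in auto)
    moreover have "bounded (G y ` {a..b})"
      by (intro compact_imp_bounded compact_continuous_image Gc) auto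
    then have "bounded (range (\<lambda>t. G y (\<tau> t)))"
      by (rule bounded_subset) (use \<tau> in auto)
    ultimately show ?thesis by (simp add: bcontfun_def)
  qed
  then have app: "apply_bcontfun (Bcontfun (\<lambda>t. G y (\<tau> t))) t = G y (\<tau> t)" for y t
    by (simp add: Bcontfun_inverse)
  have "\<exists>!y. Bcontfun (\<lambda>t. G y (\<tau> t)) = y"
  proof (rule banach_fix_type[of "1 / 2"], simp, simp, intro allI)
    fix y z :: "real \<Rightarrow>\<^sub>C 'a"
    show "dist (Bcontfun (\<lambda>t. G y (\<tau> t))) (Bcontfun (\<lambda>t. G z (\<tau> t))) \<le> 1 / 2 * dist y z"
    proof (rule dist_bound, unfold app)
      fix t
      let ?D = "\<lambda>s. F s (exp (\<mu> * s) *\<^sub>R apply_bcontfun y s) - F s (exp (\<mu> * s) *\<^sub>R apply_bcontfun z s)"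
      have "norm (?D s) \<le> M * dist y z * exp (\<mu> * s)" if s: "s \<in> {a..b}" for s
      proof -
        have "norm (?D s) \<le> M * norm (exp (\<mu> * s) *\<^sub>R (apply_bcontfun y s - apply_bcontfun z s))"
          using Lip[OF s] by (simp add: scaleR_diff_right)
        also have "\<dots> \<le> M * (exp (\<mu> * s) * dist y z)"
          using dist_bounded[of y s z] assms(2)
          by (intro mult_left_mono) (auto simp: dist_norm intro!: mult_left_mono)
        finally show ?thesis by (simp add: ac_simps)
      qed
      then have "norm (causal_conv K a b ?D (\<tau> t)) \<le>
          M * dist y z * (\<integral>s. K s * exp (- \<mu> * s) \<partial>lborel) * exp (\<mu> * \<tau> t)"
        using \<mu>(1) assms(2) by (intro norm_causal_conv_le_exp continuous_intros Fy) auto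
      also have "\<dots> \<le> M * dist y z * l * exp (\<mu> * \<tau> t)"
        using \<mu>(2) assms(2) by (intro mult_right_mono mult_left_mono) auto
      also have "\<dots> = (M * l) * dist y z * exp (\<mu> * \<tau> t)" by simp
      also have "\<dots> \<le> 1 / 2 * dist y z * exp (\<mu> * \<tau> t)"
        using l(2) by (intro mult_right_mono) auto
      finally have *: "norm (causal_conv K a b ?D (\<tau> t)) \<le> 1 / 2 * dist y z * exp (\<mu> * \<tau> t)" .
      have "dist (G y (\<tau> t)) (G z (\<tau> t)) = exp (- \<mu> * \<tau> t) * norm (causal_conv K a b ?D (\<tau> t))"
        by (simp add: G_def dist_norm causal_conv_diff[OF Fy Fy] flip: scaleR_diff_right)
      also have "\<dots> \<le> exp (- \<mu> * \<tau> t) * (1 / 2 * dist y z * exp (\<mu> * \<tau> t))"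
        by (rule mult_left_mono[OF *]) simp
      also have "\<dots> = 1 / 2 * dist y z" by (simp add: exp_minus)
      finally show "dist (G y (\<tau> t)) (G z (\<tau> t)) \<le> 1 / 2 * dist y z" .
    qed
  qed
  then obtain y where y: "Bcontfun (\<lambda>t. G y (\<tau> t)) = y" by blast
  have fixed: "apply_bcontfun y t = G y t" if "t \<in> {a..b}" for t
    using app[of y t] that unfolding y by (simp add: \<tau>_def)
  show ?thesis
  proof (intro exI[of _ "\<lambda>t. exp (\<mu> * t) *\<^sub>R apply_bcontfun y t"] conjI ballI)
    show "continuous_on {a..b} (\<lambda>t. exp (\<mu> * t) *\<^sub>R apply_bcontfun y t)"
      by (intro continuous_intros) auto
    fix t assume "t \<in> {a..b}"
    then show "exp (\<mu> * t) *\<^sub>R apply_bcontfun y t =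
        A + causal_conv K a b (\<lambda>s. F s (exp (\<mu> * s) *\<^sub>R apply_bcontfun y s)) t"
      by (simp add: fixed G_def flip: exp_add)
  qed
qed

lemma Volterra_unique:
  fixes F :: "real \<Rightarrow> 'a \<Rightarrow> 'a::euclidean_space"
  assumes "a \<le> b" "0 \<le> M"
    and Fc: "\<And>x. continuous_on {a..b} x \<Longrightarrow> continuous_on {a..b} (\<lambda>t. F t (x t))"
    and Lip: "\<And>t x y. t \<in> {a..b} \<Longrightarrow> norm (F t x - F t y) \<le> M * norm (x - y)"
    and x: "continuous_on {a..b} x" "\<And>t. t \<in> {a..b} \<Longrightarrow> x t = A + causal_conv K a b (\<lambda>s. F s (x s)) t"
    and y: "continuous_on {a..b} y" "\<And>t. t \<in> {a..b} \<Longrightarrow> y t = A + causal_conv K a b (\<lambda>s. F s (y s)) t"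
    and t: "t \<in> {a..b}"
  shows "x t = y t"
proof -
  obtain C where C: "\<And>\<Delta> \<psi> :: real \<Rightarrow> 'a. \<And>\<eta>. \<lbrakk>0 \<le> \<eta>; continuous_on {a..b} \<Delta>; continuous_on {a..b} \<psi>;
      \<forall>t\<in>{a..b}. \<Delta> t = causal_conv K a b \<psi> t; \<forall>t\<in>{a..b}. norm (\<psi> t) \<le> M * norm (\<Delta> t) + \<eta>\<rbrakk>
      \<Longrightarrow> \<forall>t\<in>{a..b}. norm (\<Delta> t) \<le> C * \<eta>"
    using causal_conv_Gronwall[OF assms(1,2)] by metis
  have "\<forall>t\<in>{a..b}. norm (x t - y t) \<le> C * 0"
  proof (rule C[where \<psi> = "\<lambda>t. F t (x t) - F t (y t)"])
    show "\<forall>t\<in>{a..b}. x t - y t = causal_conv K a b (\<lambda>t. F t (x t) - F t (y t)) t"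
      using x(2) y(2) by (simp add: causal_conv_diff Fc x(1) y(1))
    show "\<forall>t\<in>{a..b}. norm (F t (x t) - F t (y t)) \<le> M * norm (x t - y t) + 0"
      using Lip by simp
  qed (auto intro!: continuous_intros Fc x(1) y(1))
  then show ?thesis using t by auto
qed

end

section \<open>Fractional integrals and the Caputo equation\<close>

text \<open>
  The Riemann--Liouville kernel, cut off at \<open>T\<close> to make it integrable over the line. With
  \<open>T = b - a\<close> the cut-off is invisible for arguments \<open>t - y\<close> with \<open>t\<close> and \<open>y\<close> in \<open>{a..b}\<close>.
\<close>

definition frac_kernel :: "real \<Rightarrow> real \<Rightarrow> real \<Rightarrow> real" where
  "frac_kernel \<beta> T s = (if 0 < s \<and> s \<le> T then s powr (\<beta> - 1) / Gamma \<beta> else 0)"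

lemma causal_kernel_frac_kernel:
  assumes "0 < \<beta>" "0 \<le> T"
  shows "causal_kernel (frac_kernel \<beta> T)"
proof
  have "(\<lambda>x. x powr (\<beta> - 1)) absolutely_integrable_on {0<..T}"
    using assms by (intro nonnegative_absolutely_integrable_1 integrable_on_powr_from_0') auto
  then have "integrable lborel (\<lambda>x. indicator {0<..T} x *\<^sub>R x powr (\<beta> - 1))"
    unfolding set_integrable_def by (subst (asm) integrable_completion) auto
  then have "integrable lborel (\<lambda>x. (indicator {0<..T} x *\<^sub>R x powr (\<beta> - 1)) / Gamma \<beta>)"
    by (rule integrable_divide_zero)
  moreover have "(\<lambda>x. (indicator {0<..T} x *\<^sub>R x powr (\<beta> - 1)) / Gamma \<beta>) = frac_kernel \<beta> T"
    by (auto simp: frac_kernel_def)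
  ultimately show "integrable lborel (frac_kernel \<beta> T)" by simp
qed (use assms in \<open>auto simp: frac_kernel_def\<close>)

lemma causal_conv_frac_kernel_eq_integral:
  fixes g :: "real \<Rightarrow> 'a::euclidean_space"
  assumes \<beta>: "0 < \<beta>" and g: "continuous_on {a..b} g" and t: "t \<in> {a..b}"
  shows "causal_conv (frac_kernel \<beta> (b - a)) a b g t =
         (1 / Gamma \<beta>) *\<^sub>R integral {a..t} (\<lambda>y. (t - y) powr (\<beta> - 1) *\<^sub>R g y)"
proof -
  let ?K = "frac_kernel \<beta> (b - a)"
  interpret causal_kernel ?K using \<beta> t by (intro causal_kernel_frac_kernel) auto
  have "causal_conv ?K a b g t = (LINT y:{a..t}|lborel. ?K (t - y) *\<^sub>R g y)"
    unfolding causal_conv_def set_lebesgue_integral_def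
    by (rule Bochner_Integration.integral_cong) (use t in \<open>auto simp: frac_kernel_def indicator_def\<close>)
  also have "\<dots> = integral {a..t} (\<lambda>y. ?K (t - y) *\<^sub>R g y)"
    by (rule set_borel_integral_eq_integral)
       (rule set_integrable_subset[OF set_integrable_kernel[OF g]], use t in auto)
  also have "\<dots> = integral {a..t} (\<lambda>y. (1 / Gamma \<beta>) *\<^sub>R ((t - y) powr (\<beta> - 1) *\<^sub>R g y))"
    by (rule Henstock_Kurzweil_Integration.integral_cong) (use t in \<open>auto simp: frac_kernel_def\<close>)
  finally show ?thesis by (simp only: integral_cmul)
qed

lemma frac_int_left_eq_causal_conv:
  fixes g :: "real \<Rightarrow> 'a::euclidean_space"
  assumes "0 < \<beta>" "continuous_on {a..b} g" "t \<in> {a..b}"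
  shows "frac_int_left a \<beta> g t = causal_conv (frac_kernel \<beta> (b - a)) a b g t"
  using causal_conv_frac_kernel_eq_integral[OF assms] assms(1) by (simp add: frac_int_left_def)

lemma causal_conv_frac_kernel_one:
  fixes g :: "real \<Rightarrow> 'a::euclidean_space"
  assumes "continuous_on {a..b} g" "t \<in> {a..b}"
  shows "causal_conv (frac_kernel 1 (b - a)) a b g t = integral {a..t} g"
proof -
  have "integral {a..t} (\<lambda>y. (t - y) powr (1 - 1) *\<^sub>R g y) = integral {a..t} g"
    by (rule integral_spike[of "{t}"]) auto
  then show ?thesis
    using causal_conv_frac_kernel_eq_integral[OF zero_less_one assms] by simp
qed

text \<open>
  Substituting \<open>s = y + (t - y) * x\<close> turns the integral into Euler's Beta integral. The variable \<open>s\<close>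
  is confined to \<open>{y<..<t}\<close>, where the indicator is 1 and the cut-offs are inactive.
\<close>

lemma frac_kernel_convolution:
  assumes \<alpha>: "0 < \<alpha>" and \<beta>: "0 < \<beta>" and t: "t \<in> {a..b}" and y: "y \<in> {a..b}"
  shows "(\<integral>s. frac_kernel \<beta> (b - a) (s - y) * (indicator {a..b} s * frac_kernel \<alpha> (b - a) (t - s)) \<partial>lborel)
         = frac_kernel (\<alpha> + \<beta>) (b - a) (t - y)" (is "integral\<^sup>L lborel ?F = _")
proof (cases "y < t")
  case False
  then have "?F = (\<lambda>_. 0)" by (auto simp: frac_kernel_def fun_eq_iff)
  then show ?thesis using False by (simp add: frac_kernel_def)
next
  case True
  define c where "c = t - y"
  have c: "0 < c" using True by (simp add: c_def)
  let ?b = "\<lambda>x::real. x powr (\<beta> - 1) * (1 - x) powr (\<alpha> - 1)"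
  have B: "(?b has_integral Beta \<beta> \<alpha>) {0..1}" by (rule has_integral_Beta_real[OF \<beta> \<alpha>])
  then have "?b absolutely_integrable_on {0..1}"
    by (intro nonnegative_absolutely_integrable_1) auto
  from set_lebesgue_integral_eq_integral(2)[OF this]
  have LB: "(\<integral>x. indicator {0..1} x * ?b x \<partial>lborel) = Beta \<beta> \<alpha>"
    using B unfolding set_lebesgue_integral_def
    by (subst (asm) integral_completion) (auto simp: integral_unique)
  have "?F (y + c * x) = (c powr (\<alpha> + \<beta> - 2) / (Gamma \<alpha> * Gamma \<beta>)) * (indicator {0..1} x * ?b x)" for x
  proof (cases "0 < x \<and> x < 1")
    case True
    then have *: "0 < c * x" "c * x < c" using c by auto
    have **: "t - (y + c * x) = c * (1 - x)" by (simp add: c_def algebra_simps)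
    have "0 < c * (1 - x)" "c * (1 - x) \<le> b - a"
      using * t y by (auto simp: algebra_simps c_def)
    then have "?F (y + c * x) = ((c * x) powr (\<beta> - 1) / Gamma \<beta>) * ((c * (1 - x)) powr (\<alpha> - 1) / Gamma \<alpha>)"
      unfolding ** using * t y by (auto simp: frac_kernel_def c_def indicator_def)
    also have "\<dots> = (c powr (\<beta> - 1) * c powr (\<alpha> - 1)) / (Gamma \<alpha> * Gamma \<beta>) * ?b x"
      using True c by (simp add: powr_mult mult.commute mult.left_commute)
    also have "c powr (\<beta> - 1) * c powr (\<alpha> - 1) = c powr (\<alpha> + \<beta> - 2)"
      by (simp add: algebra_simps flip: powr_add)
    finally show ?thesis using True by simp
  next
    case False
    have "?F (y + c * x) = 0"
    proof (cases "0 < x")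
      case True
      then have "c * 1 \<le> c * x" using False c by (intro mult_left_mono) auto
      then show ?thesis by (simp add: frac_kernel_def c_def)
    next
      case False
      then have "c * x \<le> 0" using c by (simp add: mult_nonneg_nonpos)
      then show ?thesis by (simp add: frac_kernel_def)
    qed
    moreover have "indicator {0..1} x * ?b x = 0"
      using False by (cases "x = 0 \<or> x = 1") (auto simp: indicator_def)
    ultimately show ?thesis by (simp only: mult_zero_right)
  qed
  then have "(\<integral>x. ?F (y + c * x) \<partial>lborel) =
      (c powr (\<alpha> + \<beta> - 2) / (Gamma \<alpha> * Gamma \<beta>)) * Beta \<beta> \<alpha>"
    by (simp only: integral_mult_right_zero LB)
  then have "integral\<^sup>L lborel ?F = c * c powr (\<alpha> + \<beta> - 2) / (Gamma \<alpha> * Gamma \<beta>) * Beta \<beta> \<alpha>"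
    using c by (subst lborel_integral_real_affine[of c _ y]) auto
  also have "c * c powr (\<alpha> + \<beta> - 2) = c powr (\<alpha> + \<beta> - 1)"
    using c powr_add[of c 1 "\<alpha> + \<beta> - 2"] by (simp add: algebra_simps)
  also have "c powr (\<alpha> + \<beta> - 1) / (Gamma \<alpha> * Gamma \<beta>) * Beta \<beta> \<alpha> = c powr (\<alpha> + \<beta> - 1) / Gamma (\<alpha> + \<beta>)"
    using Gamma_real_pos[OF \<alpha>] Gamma_real_pos[OF \<beta>] by (simp add: Beta_def ac_simps)
  finally show ?thesis using t y True by (auto simp: frac_kernel_def c_def)
qed

lemma frac_int_semigroup:
  fixes h :: "real \<Rightarrow> 'a::euclidean_space"
  assumes \<alpha>: "0 < \<alpha>" and \<beta>: "0 < \<beta>" and h: "continuous_on {a..b} h" and t: "t \<in> {a..b}"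
  shows "causal_conv (frac_kernel \<alpha> (b - a)) a b (causal_conv (frac_kernel \<beta> (b - a)) a b h) t =
         causal_conv (frac_kernel (\<alpha> + \<beta>) (b - a)) a b h t"
proof -
  let ?A = "frac_kernel \<alpha> (b - a)" and ?B = "frac_kernel \<beta> (b - a)"
  interpret A: causal_kernel ?A using \<alpha> t by (intro causal_kernel_frac_kernel) auto
  interpret B: causal_kernel ?B using \<beta> t by (intro causal_kernel_frac_kernel) auto
  let ?h = "\<lambda>y. indicator {a..b} y *\<^sub>R h y"
  let ?g = "\<lambda>s. indicator {a..b} s * ?A (t - s)"
  obtain C where C: "\<And>y. norm (?h y) \<le> C"
    using zero_extension_measurable_bounded(2)[OF h] by blast
  have g: "integrable lborel ?g"
    using A.set_integrable_kernel[of a b "\<lambda>_. 1 :: real" t] by (simp add: set_integrable_def)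
  have "causal_conv ?A a b (causal_conv ?B a b h) t = (\<integral>s. ?g s *\<^sub>R (\<integral>y. ?B (s - y) *\<^sub>R ?h y \<partial>lborel) \<partial>lborel)"
    by (simp add: causal_conv_def set_lebesgue_integral_def mult.commute)
  also have "\<dots> = (\<integral>y. (\<integral>s. ?B (s - y) *\<^sub>R ?g s \<partial>lborel) *\<^sub>R ?h y \<partial>lborel)"
    by (rule B.Fubini_kernel[OF bounded_bilinear_scaleR g zero_extension_measurable_bounded(1)[OF h] C])
  also have "\<dots> = (\<integral>y. indicator {a..b} y *\<^sub>R (frac_kernel (\<alpha> + \<beta>) (b - a) (t - y) *\<^sub>R h y) \<partial>lborel)"
  proof (rule Bochner_Integration.integral_cong[OF refl])
    fix y
    show "(\<integral>s. ?B (s - y) *\<^sub>R ?g s \<partial>lborel) *\<^sub>R ?h y =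
      indicator {a..b} y *\<^sub>R (frac_kernel (\<alpha> + \<beta>) (b - a) (t - y) *\<^sub>R h y)"
      using frac_kernel_convolution[OF \<alpha> \<beta> t, of y] by (cases "y \<in> {a..b}") auto
  qed
  finally show ?thesis by (simp add: causal_conv_def set_lebesgue_integral_def)
qed

text \<open>
  Fractional integrals of orders \<open>\<alpha>\<close> and \<open>1 - \<alpha>\<close> compose to the ordinary primitive. For \<open>\<alpha> = 1\<close>
  this is not an instance of the semigroup law, because the integral of order 0 is the identity and
  has no kernel.
\<close>

lemma frac_int_complementary:
  fixes h :: "real \<Rightarrow> 'a::euclidean_space"
  assumes \<alpha>: "0 < \<alpha>" "\<alpha> \<le> 1" and h: "continuous_on {a..b} h" and t: "t \<in> {a..b}"
  shows "causal_conv (frac_kernel \<alpha> (b - a)) a b (frac_int_left a (1 - \<alpha>) h) t = integral {a..t} h"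
    and "frac_int_left a (1 - \<alpha>) (causal_conv (frac_kernel \<alpha> (b - a)) a b h) t = integral {a..t} h"
proof -
  let ?A = "frac_kernel \<alpha> (b - a)" and ?B = "frac_kernel (1 - \<alpha>) (b - a)"
  interpret A: causal_kernel ?A using \<alpha> t by (intro causal_kernel_frac_kernel) auto
  note one = causal_conv_frac_kernel_one[OF h t]
  have "causal_conv ?A a b (frac_int_left a (1 - \<alpha>) h) t = integral {a..t} h \<and>
        frac_int_left a (1 - \<alpha>) (causal_conv ?A a b h) t = integral {a..t} h"
  proof (cases "\<alpha> = 1")
    case True
    then show ?thesis using one by (simp add: frac_int_left_def[abs_def])
  next
    case False
    then have \<beta>: "0 < 1 - \<alpha>" using \<alpha> by simp
    have "causal_conv ?A a b (frac_int_left a (1 - \<alpha>) h) t = causal_conv ?A a b (causal_conv ?B a b h) t"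
      by (rule causal_conv_cong) (rule frac_int_left_eq_causal_conv[OF \<beta> h])
    moreover have "frac_int_left a (1 - \<alpha>) (causal_conv ?A a b h) t = causal_conv ?B a b (causal_conv ?A a b h) t"
      by (rule frac_int_left_eq_causal_conv[OF \<beta> A.continuous_on_causal_conv[OF h] t])
    ultimately show ?thesis
      using frac_int_semigroup[OF \<alpha>(1) \<beta> h t] frac_int_semigroup[OF \<beta> \<alpha>(1) h t] one by simp
  qed
  then show "causal_conv (frac_kernel \<alpha> (b - a)) a b (frac_int_left a (1 - \<alpha>) h) t = integral {a..t} h"
    and "frac_int_left a (1 - \<alpha>) (causal_conv (frac_kernel \<alpha> (b - a)) a b h) t = integral {a..t} h" by auto
qed

lemma integral_eq_imp_eq:
  fixes g h :: "real \<Rightarrow> 'a::euclidean_space"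
  assumes "a < b" "continuous_on {a..b} g" "continuous_on {a..b} h"
    and eq: "\<And>t. t \<in> {a..b} \<Longrightarrow> integral {a..t} g = integral {a..t} h" and t: "t \<in> {a..b}"
  shows "g t = h t"
proof -
  have "((\<lambda>s. integral {a..s} g) has_vector_derivative g t) (at t within {a..b})"
    by (rule integral_has_vector_derivative[OF assms(2) t])
  moreover have "((\<lambda>s. integral {a..s} g) has_vector_derivative h t) (at t within {a..b})"
    by (rule has_vector_derivative_transform[OF t eq integral_has_vector_derivative[OF assms(3) t]])
  ultimately show ?thesis
    using vector_derivative_within_cbox[OF assms(1), of t] t by (metis cbox_interval)
qed

text \<open>
  The Caputo equation says that \<open>G\<close>, the integral of order \<open>1 - \<alpha>\<close> of \<open>q - A\<close>, has derivative \<open>\<phi>\<close>,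
  while the integral equation says that \<open>q - A\<close> is the integral of order \<open>\<alpha>\<close> of \<open>\<phi>\<close>. Passing from
  the former to the latter, an integration of order \<open>\<alpha>\<close> is applied to \<open>G t = integral {a..t} \<phi>\<close>; by
  commutativity both sides then become ordinary primitives, whose integrands must agree.
\<close>

lemma Caputo_left_iff_integral_equation:
  fixes q \<phi> :: "real \<Rightarrow> 'a::euclidean_space"
  assumes "a < b" and \<alpha>: "0 < \<alpha>" "\<alpha> \<le> 1"
    and q: "continuous_on {a..b} q" and \<phi>: "continuous_on {a..b} \<phi>"
  shows "(q a = A \<and> (\<forall>t\<in>{a<..b}. has_Caputo_left a b \<alpha> q (\<phi> t) t)) \<longleftrightarrow>
         (\<forall>t\<in>{a..b}. q t = A + causal_conv (frac_kernel \<alpha> (b - a)) a b \<phi> t)"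
    (is "?L \<longleftrightarrow> ?R")
proof
  let ?A = "frac_kernel \<alpha> (b - a)"
  interpret A: causal_kernel ?A using \<alpha> assms(1) by (intro causal_kernel_frac_kernel) auto
  let ?G = "frac_int_left a (1 - \<alpha>) (\<lambda>s. q s - A)"
  have qA: "continuous_on {a..b} (\<lambda>s. q s - A)" by (intro continuous_intros q)
  {
    assume ?L
    then have qa: "q a = A" and der: "\<And>t. t \<in> {a<..b} \<Longrightarrow> (?G has_vector_derivative \<phi> t) (at t within {a..b})"
      by (auto simp: has_Caputo_left_def has_RL_left_def)
    have Gc: "continuous_on {a..b} ?G"
    proof (cases "\<alpha> = 1")
      case True
      then show ?thesis using qA by (simp add: frac_int_left_def)
    next
      case False
      then interpret B: causal_kernel "frac_kernel (1 - \<alpha>) (b - a)"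
        using \<alpha> assms(1) by (intro causal_kernel_frac_kernel) auto
      show ?thesis
        by (rule continuous_on_eq[OF B.continuous_on_causal_conv[OF qA]])
           (rule frac_int_left_eq_causal_conv[symmetric, OF _ qA], use \<alpha> False in auto)
    qed
    have Ga: "?G a = 0" using qa by (simp add: frac_int_left_def)
    have G: "?G t = integral {a..t} \<phi>" if t: "t \<in> {a..b}" for t
    proof -
      have "(\<phi> has_integral (?G t - ?G a)) {a..t}"
      proof (rule fundamental_theorem_of_calculus_interior)
        show "continuous_on {a..t} ?G" by (rule continuous_on_subset[OF Gc]) (use t in auto)
        fix x assume "x \<in> {a<..<t}"
        then have "x \<in> {a<..<b}" "x \<in> {a<..b}" using t by auto
        then show "(?G has_vector_derivative \<phi> x) (at x)"
          using der[of x] at_within_Icc_at[of a x b] by auto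
      qed (use t in auto)
      then show ?thesis using Ga by (simp add: integral_unique)
    qed
    have "q t - A = causal_conv ?A a b \<phi> t" if "t \<in> {a..b}" for t
    proof (rule integral_eq_imp_eq[OF assms(1) qA A.continuous_on_causal_conv[OF \<phi>] _ that])
      fix t assume t: "t \<in> {a..b}"
      have J: "integral {a..s} \<phi> = causal_conv (frac_kernel 1 (b - a)) a b \<phi> s" if "s \<in> {a..b}" for s
        by (rule causal_conv_frac_kernel_one[OF \<phi> that, symmetric])
      have "integral {a..t} (\<lambda>s. q s - A) = causal_conv ?A a b ?G t"
        by (rule frac_int_complementary(1)[OF \<alpha> qA t, symmetric])
      also have "\<dots> = causal_conv ?A a b (causal_conv (frac_kernel 1 (b - a)) a b \<phi>) t"
        by (rule causal_conv_cong) (simp add: G J)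
      also have "\<dots> = causal_conv (frac_kernel 1 (b - a)) a b (causal_conv ?A a b \<phi>) t"
        using frac_int_semigroup[OF \<alpha>(1) zero_less_one \<phi> t] frac_int_semigroup[OF zero_less_one \<alpha>(1) \<phi> t]
        by (simp add: add.commute)
      also have "\<dots> = integral {a..t} (causal_conv ?A a b \<phi>)"
        by (rule causal_conv_frac_kernel_one[OF A.continuous_on_causal_conv[OF \<phi>] t])
      finally show "integral {a..t} (\<lambda>s. q s - A) = integral {a..t} (causal_conv ?A a b \<phi>)" .
    qed
    then show ?R by (metis add.commute diff_add_cancel)
  }
  {
    assume R: ?R
    have "causal_conv ?A a b \<phi> a = 0"
      unfolding causal_conv_def set_lebesgue_integral_def
      by (rule integral_eq_zero_AE) (auto simp: frac_kernel_def)
    then have qa: "q a = A" using R assms(1) by auto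
    have G: "?G t = integral {a..t} \<phi>" if t: "t \<in> {a..b}" for t
    proof -
      have "?G t = frac_int_left a (1 - \<alpha>) (causal_conv ?A a b \<phi>) t"
        unfolding frac_int_left_def
        using R t by (auto intro!: Henstock_Kurzweil_Integration.integral_cong)
      then show ?thesis using frac_int_complementary(2)[OF \<alpha> \<phi> t] by simp
    qed
    have "(?G has_vector_derivative \<phi> t) (at t within {a..b})" if t: "t \<in> {a..b}" for t
      by (rule has_vector_derivative_transform[OF t G integral_has_vector_derivative[OF \<phi> t]])
    then show ?L using qa by (auto simp: has_Caputo_left_def has_RL_left_def)
  }
qed

lemma continuous_on_C1_on: "C1_on S g \<Longrightarrow> continuous_on S g"
  by (auto simp: C1_on_def continuous_on_eq_continuous_within dest: has_derivative_continuous)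

lemma continuous_on_C_floor_on: "C_floor_on \<alpha> S g \<Longrightarrow> continuous_on S g"
  by (auto simp: C_floor_on_def dest: continuous_on_C1_on split: if_splits)

lemma C_floor_on_frac_int:
  fixes q \<phi> :: "real \<Rightarrow> 'a::euclidean_space"
  assumes \<alpha>: "0 < \<alpha>" "\<alpha> \<le> 1"
    and q: "continuous_on {a..b} q" and \<phi>: "continuous_on {a..b} \<phi>"
    and eq: "\<And>t. t \<in> {a..b} \<Longrightarrow> q t = A + causal_conv (frac_kernel \<alpha> (b - a)) a b \<phi> t"
  shows "C_floor_on \<alpha> {a..b} q"
proof (cases "\<alpha> = 1")
  case False
  then have "\<lfloor>\<alpha>\<rfloor> = 0" using \<alpha> by (simp add: floor_eq_iff)
  then show ?thesis using q by (simp add: C_floor_on_def)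
next
  case True
  have eq': "q t = A + integral {a..t} \<phi>" if "t \<in> {a..b}" for t
    using eq[OF that] causal_conv_frac_kernel_one[OF \<phi> that] True by simp
  have "(q has_vector_derivative \<phi> t) (at t within {a..b})" if t: "t \<in> {a..b}" for t
  proof (rule has_vector_derivative_transform[OF t eq'])
    show "((\<lambda>s. A + integral {a..s} \<phi>) has_vector_derivative \<phi> t) (at t within {a..b})"
      using integral_has_vector_derivative[OF \<phi> t] by (auto intro!: derivative_eq_intros)
  qed
  moreover have "continuous_on {a..b} (\<lambda>t. blinfun_scaleR_left (\<phi> t))"
    by (rule bounded_linear.continuous_on[OF bounded_linear_blinfun_scaleR_left \<phi>])
  ultimately have "C1_on {a..b} q"
    unfolding C1_on_def has_vector_derivative_def
    by (intro exI[of _ "\<lambda>t. blinfun_scaleR_left (\<phi> t)"]) auto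
  then show ?thesis using True by (simp add: C_floor_on_def)
qed

text \<open>
  The equivalence above with the regularity class included: for \<open>\<alpha> = 1\<close> the integral equation itself
  provides the required continuous derivative.
\<close>

lemma Caputo_left_problem_iff:
  fixes q \<phi> :: "real \<Rightarrow> 'a::euclidean_space"
  assumes "a < b" "0 < \<alpha>" "\<alpha> \<le> 1"
  shows "(C_floor_on \<alpha> {a..b} q \<and> q a = A \<and> Caputo_left_eq a b \<alpha> q \<phi>) \<longleftrightarrow>
    (continuous_on {a..b} q \<and> continuous_on {a..b} \<phi> \<and>
     (\<forall>t\<in>{a..b}. q t = A + causal_conv (frac_kernel \<alpha> (b - a)) a b \<phi> t))"
proof (cases "continuous_on {a..b} q \<and> continuous_on {a..b} \<phi>")
  case True
  then show ?thesis
    using Caputo_left_iff_integral_equation[OF assms, of q \<phi> A] C_floor_on_frac_int[OF assms(2,3), of a b q \<phi> A]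
    unfolding Caputo_left_eq_def by blast
next
  case False
  then show ?thesis using continuous_on_C_floor_on[of \<alpha> "{a..b}" q] unfolding Caputo_left_eq_def by blast
qed

section \<open>Time reversal and the right-sided operators\<close>

lemma continuous_on_reflect:
  fixes g :: "real \<Rightarrow> 'a::topological_space"
  shows "continuous_on {a..b} g \<Longrightarrow> continuous_on {a..b} (\<lambda>s. g (a + b - s))"
  by (rule continuous_on_compose2[of "{a..b}" g]) (auto intro!: continuous_intros)

lemma has_derivative_reflect:
  fixes g :: "real \<Rightarrow> 'a::real_normed_vector"
  assumes "(g has_derivative D) (at (a + b - t) within {a..b})"
  shows "((\<lambda>s. g (a + b - s)) has_derivative (\<lambda>h. D (- h))) (at t within {a..b})"
proof (rule has_derivative_in_compose[where f = "\<lambda>s. a + b - s"])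
  show "((\<lambda>s. a + b - s) has_derivative uminus) (at t within {a..b})"
    by (auto intro!: derivative_eq_intros)
  show "(g has_derivative D) (at (a + b - t) within (\<lambda>s. a + b - s) ` {a..b})"
    by (rule has_derivative_subset[OF assms]) auto
qed

lemma has_vector_derivative_reflect:
  fixes g :: "real \<Rightarrow> 'a::real_normed_vector"
  assumes "(g has_vector_derivative D) (at (a + b - t) within {a..b})"
  shows "((\<lambda>s. - g (a + b - s)) has_vector_derivative D) (at t within {a..b})"
  using has_derivative_minus[OF has_derivative_reflect[OF assms[unfolded has_vector_derivative_def]]]
  by (simp add: has_vector_derivative_def)

lemma integral_reflect_Icc:
  fixes g :: "real \<Rightarrow> 'a::real_normed_vector"
  shows "integral {t..b} g = integral {a..a + b - t} (\<lambda>s. g (a + b - s))"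
proof -
  have refl: "((\<lambda>s. g (c - s)) has_integral i) {c - v..c - u}" if "(g has_integral i) {u..v}"
    for g :: "real \<Rightarrow> 'a" and u v c i
  proof (cases "u \<le> v")
    case True
    have "(\<lambda>x. - x - - c) ` cbox u v = {c - v..c - u}"
      using True image_affinity_atLeastAtMost[of "-1" c u v] by simp
    then show ?thesis
      using has_integral_affinity[of g i u v "-1" c] that by (simp add: algebra_simps)
  qed (use that in simp)
  have "(g has_integral i) {t..b} \<longleftrightarrow> ((\<lambda>s. g (a + b - s)) has_integral i) {a..a + b - t}" for i
    using refl[of g i t b "a + b"] refl[of "\<lambda>s. g (a + b - s)" i a "a + b - t" "a + b"] by auto
  then show ?thesis unfolding integral_def integrable_on_def by simp
qed

lemma frac_int_right_reflect:
  "frac_int_right b \<beta> g t = frac_int_left a \<beta> (\<lambda>s. g (a + b - s)) (a + b - t)"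
  unfolding frac_int_left_def frac_int_right_def
  by (simp add: integral_reflect_Icc[of t b _ a] algebra_simps)

lemma has_Caputo_right_reflect:
  "has_Caputo_right a b \<alpha> p D t \<longleftrightarrow> has_Caputo_left a b \<alpha> (\<lambda>s. p (a + b - s)) D (a + b - t)"
proof -
  let ?G = "frac_int_left a (1 - \<alpha>) (\<lambda>s. p (a + b - s) - p b)"
  have "((\<lambda>s. - ?G (a + b - s)) has_vector_derivative D) (at t within {a..b}) \<longleftrightarrow>
        (?G has_vector_derivative D) (at (a + b - t) within {a..b})"
    using has_vector_derivative_reflect[of ?G D a b t]
      has_vector_derivative_reflect[of "\<lambda>s. - ?G (a + b - s)" D a b "a + b - t"] by auto
  then show ?thesis
    by (simp add: has_Caputo_left_def has_Caputo_right_def has_RL_left_def has_RL_right_def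
        frac_int_right_reflect[of b _ _ _ a])
qed

lemma C1_on_reflect:
  fixes g :: "real \<Rightarrow> 'a::real_normed_vector"
  assumes "C1_on {a..b} g"
  shows "C1_on {a..b} (\<lambda>s. g (a + b - s))"
proof -
  obtain g' :: "real \<Rightarrow> real \<Rightarrow>\<^sub>L 'a" where
    g': "\<And>t. t \<in> {a..b} \<Longrightarrow> (g has_derivative g' t) (at t within {a..b})" "continuous_on {a..b} g'"
    using assms unfolding C1_on_def by blast
  have "((\<lambda>s. g (a + b - s)) has_derivative (- g' (a + b - t))) (at t within {a..b})" if "t \<in> {a..b}" for t
    using has_derivative_reflect[OF g'(1), of t] that
    by (simp add: blinfun.minus_right uminus_blinfun.rep_eq)
  then show ?thesis
    unfolding C1_on_def using continuous_on_reflect[OF g'(2)]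
    by (intro exI[of _ "\<lambda>t. - g' (a + b - t)"]) (auto intro: continuous_intros)
qed

lemma C_floor_on_reflect_iff:
  fixes g :: "real \<Rightarrow> 'a::real_normed_vector"
  shows "C_floor_on \<alpha> {a..b} (\<lambda>s. g (a + b - s)) \<longleftrightarrow> C_floor_on \<alpha> {a..b} g"
  unfolding C_floor_on_def
  using C1_on_reflect[of a b g] C1_on_reflect[of a b "\<lambda>s. g (a + b - s)"]
    continuous_on_reflect[of a b g] continuous_on_reflect[of a b "\<lambda>s. g (a + b - s)"] by auto

lemma continuous_on_reflect_iff:
  fixes g :: "real \<Rightarrow> 'a::topological_space"
  shows "continuous_on {a..b} (\<lambda>s. g (a + b - s)) \<longleftrightarrow> continuous_on {a..b} g"
  using continuous_on_reflect[of a b g] continuous_on_reflect[of a b "\<lambda>s. g (a + b - s)"] by auto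

lemma ball_reflect_iff:
  fixes a b :: real
  shows "(\<forall>t\<in>{a..b}. P (a + b - t)) \<longleftrightarrow> (\<forall>t\<in>{a..b}. P t)"
    and "(\<forall>t\<in>{a..<b}. P (a + b - t)) \<longleftrightarrow> (\<forall>t\<in>{a<..b}. P t)"
proof -
  have "P t" if "\<forall>t\<in>{a..b}. P (a + b - t)" "t \<in> {a..b}" for t
    using bspec[OF that(1), of "a + b - t"] that(2) by simp
  then show "(\<forall>t\<in>{a..b}. P (a + b - t)) \<longleftrightarrow> (\<forall>t\<in>{a..b}. P t)" by auto
  have "P t" if "\<forall>t\<in>{a..<b}. P (a + b - t)" "t \<in> {a<..b}" for t
    using bspec[OF that(1), of "a + b - t"] that(2) by simp
  then show "(\<forall>t\<in>{a..<b}. P (a + b - t)) \<longleftrightarrow> (\<forall>t\<in>{a<..b}. P t)" by auto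
qed

lemma Caputo_right_problem_iff:
  fixes p \<phi> :: "real \<Rightarrow> 'a::euclidean_space"
  assumes "a < b" "0 < \<alpha>" "\<alpha> \<le> 1"
  shows "(C_floor_on \<alpha> {a..b} p \<and> p b = B \<and> Caputo_right_eq a b \<alpha> p \<phi>) \<longleftrightarrow>
    (continuous_on {a..b} p \<and> continuous_on {a..b} \<phi> \<and>
     (\<forall>t\<in>{a..b}. p t = B + anticausal_conv (frac_kernel \<alpha> (b - a)) a b \<phi> t))"
proof -
  have *: "Caputo_right_eq a b \<alpha> p \<phi> \<longleftrightarrow> Caputo_left_eq a b \<alpha> (\<lambda>s. p (a + b - s)) (\<lambda>s. \<phi> (a + b - s))"
    using ball_reflect_iff(2)[of a b
        "\<lambda>t. has_Caputo_left a b \<alpha> (\<lambda>s. p (a + b - s)) (\<phi> (a + b - t)) t"]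
    by (simp add: Caputo_left_eq_def Caputo_right_eq_def has_Caputo_right_reflect continuous_on_reflect_iff)
  show ?thesis
    using Caputo_left_problem_iff[OF assms, of "\<lambda>s. p (a + b - s)" B "\<lambda>s. \<phi> (a + b - s)"]
      ball_reflect_iff(1)[of a b "\<lambda>t. p (a + b - t) = B + causal_conv (frac_kernel \<alpha> (b - a)) a b (\<lambda>s. \<phi> (a + b - s)) t"]
    by (simp add: * C_floor_on_reflect_iff continuous_on_reflect_iff anticausal_conv_reflect)
qed

context causal_kernel
begin

lemma continuous_on_anticausal_conv:
  fixes h :: "real \<Rightarrow> 'a::euclidean_space"
  assumes "continuous_on {a..b} h"
  shows "continuous_on S (anticausal_conv K a b h)"
  unfolding anticausal_conv_reflect[abs_def]
  by (rule continuous_on_compose2[OF continuous_on_causal_conv[OF continuous_on_reflect[OF assms], of UNIV]])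
     (auto intro!: continuous_intros)

text \<open>Fractional integration by parts: the two one-sided integrals are adjoint to each other.\<close>

lemma integral_causal_conv_by_parts:
  fixes g h :: "real \<Rightarrow> 'a::euclidean_space"
  assumes g: "continuous_on {a..b} g" and h: "continuous_on {a..b} h"
  shows "integral {a..b} (\<lambda>t. g t \<bullet> causal_conv K a b h t) =
         integral {a..b} (\<lambda>t. anticausal_conv K a b g t \<bullet> h t)"
proof -
  let ?g = "\<lambda>y. indicator {a..b} y *\<^sub>R g y" and ?h = "\<lambda>y. indicator {a..b} y *\<^sub>R h y"
  obtain C where C: "\<And>y. norm (?h y) \<le> C"
    using zero_extension_measurable_bounded(2)[OF h] by blast
  have gi: "integrable lborel ?g"
    using borel_integrable_atLeastAtMost'[OF g] by (simp add: set_integrable_def)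
  have lborel: "integral {a..b} k = (\<integral>t. indicator {a..b} t * k t \<partial>lborel)"
    if "continuous_on {a..b} k" for k :: "real \<Rightarrow> real"
    using set_borel_integral_eq_integral(2)[OF borel_integrable_atLeastAtMost'[OF that]]
    by (simp add: set_lebesgue_integral_def)
  have "(\<integral>t. ?g t \<bullet> (\<integral>y. K (t - y) *\<^sub>R ?h y \<partial>lborel) \<partial>lborel) =
        (\<integral>y. (\<integral>t. K (t - y) *\<^sub>R ?g t \<partial>lborel) \<bullet> ?h y \<partial>lborel)"
    by (rule Fubini_kernel[OF bounded_bilinear_inner gi zero_extension_measurable_bounded(1)[OF h] C])
  moreover have "(\<integral>t. ?g t \<bullet> (\<integral>y. K (t - y) *\<^sub>R ?h y \<partial>lborel) \<partial>lborel) =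
      integral {a..b} (\<lambda>t. g t \<bullet> causal_conv K a b h t)"
    using lborel[OF continuous_on_inner[OF g continuous_on_causal_conv[OF h]]]
    by (simp add: causal_conv_def set_lebesgue_integral_def mult.commute)
  moreover have "(\<integral>y. (\<integral>t. K (t - y) *\<^sub>R ?g t \<partial>lborel) \<bullet> ?h y \<partial>lborel) =
      integral {a..b} (\<lambda>t. anticausal_conv K a b g t \<bullet> h t)"
    using lborel[OF continuous_on_inner[OF continuous_on_anticausal_conv[OF g] h]]
    by (simp add: anticausal_conv_def set_lebesgue_integral_def mult.commute)
  ultimately show ?thesis by simp
qed

lemma Volterra_exists_anticausal:
  fixes F :: "real \<Rightarrow> 'a \<Rightarrow> 'a::euclidean_space"
  assumes "a \<le> b" "0 \<le> M"
    and Fc: "\<And>x. continuous_on {a..b} x \<Longrightarrow> continuous_on {a..b} (\<lambda>t. F t (x t))"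
    and Lip: "\<And>t x y. t \<in> {a..b} \<Longrightarrow> norm (F t x - F t y) \<le> M * norm (x - y)"
  shows "\<exists>x. continuous_on {a..b} x \<and>
             (\<forall>t\<in>{a..b}. x t = B + anticausal_conv K a b (\<lambda>s. F s (x s)) t)"
proof -
  have "\<exists>x. continuous_on {a..b} x \<and>
      (\<forall>t\<in>{a..b}. x t = B + causal_conv K a b (\<lambda>s. F (a + b - s) (x s)) t)"
  proof (rule Volterra_exists[OF assms(1,2)])
    fix x :: "real \<Rightarrow> 'a" assume "continuous_on {a..b} x"
    from continuous_on_reflect[OF Fc[OF continuous_on_reflect[OF this]]]
    show "continuous_on {a..b} (\<lambda>t. F (a + b - t) (x t))" by simp
  qed (use Lip in auto)
  then obtain x where x: "continuous_on {a..b} x"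
      "\<And>t. t \<in> {a..b} \<Longrightarrow> x t = B + causal_conv K a b (\<lambda>s. F (a + b - s) (x s)) t" by blast
  show ?thesis
    by (rule exI[of _ "\<lambda>t. x (a + b - t)"])
       (auto simp: anticausal_conv_reflect continuous_on_reflect x)
qed

lemma Volterra_unique_anticausal:
  fixes F :: "real \<Rightarrow> 'a \<Rightarrow> 'a::euclidean_space"
  assumes "a \<le> b" "0 \<le> M"
    and Fc: "\<And>x. continuous_on {a..b} x \<Longrightarrow> continuous_on {a..b} (\<lambda>t. F t (x t))"
    and Lip: "\<And>t x y. t \<in> {a..b} \<Longrightarrow> norm (F t x - F t y) \<le> M * norm (x - y)"
    and x: "continuous_on {a..b} x" "\<And>t. t \<in> {a..b} \<Longrightarrow> x t = B + anticausal_conv K a b (\<lambda>s. F s (x s)) t"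
    and y: "continuous_on {a..b} y" "\<And>t. t \<in> {a..b} \<Longrightarrow> y t = B + anticausal_conv K a b (\<lambda>s. F s (y s)) t"
    and t: "t \<in> {a..b}"
  shows "x t = y t"
proof -
  have "x (a + b - (a + b - t)) = y (a + b - (a + b - t))"
  proof (rule Volterra_unique[OF assms(1,2), where F = "\<lambda>s. F (a + b - s)" and A = B
        and x = "\<lambda>s. x (a + b - s)" and y = "\<lambda>s. y (a + b - s)"])
    fix z :: "real \<Rightarrow> 'a" assume "continuous_on {a..b} z"
    from continuous_on_reflect[OF Fc[OF continuous_on_reflect[OF this]]]
    show "continuous_on {a..b} (\<lambda>t. F (a + b - t) (z t))" by simp
  next
    fix s assume s: "s \<in> {a..b}"
    show "x (a + b - s) = B + causal_conv K a b (\<lambda>s. F (a + b - s) (x (a + b - s))) s"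
      "y (a + b - s) = B + causal_conv K a b (\<lambda>s. F (a + b - s) (y (a + b - s))) s"
      using x(2)[of "a + b - s"] y(2)[of "a + b - s"] s by (auto simp: anticausal_conv_reflect)
  qed (use Lip x y t in \<open>auto intro: continuous_on_reflect\<close>)
  then show ?thesis by simp
qed

end

section \<open>Gradients and uniform linearization\<close>

lemma continuous_on_Icc_bounded:
  fixes g :: "real \<Rightarrow> 'a::real_normed_vector"
  assumes "continuous_on {a..b} g"
  shows "\<exists>B\<ge>0. \<forall>t\<in>{a..b}. norm (g t) \<le> B"
proof -
  have "bounded (g ` {a..b})"
    by (intro compact_imp_bounded compact_continuous_image assms compact_Icc)
  then show ?thesis unfolding bounded_pos by (auto intro: less_imp_le)
qed

lemma continuous_on_if_inner:
  fixes G :: "real \<Rightarrow> 'a::euclidean_space"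
  assumes "\<And>k. continuous_on S (\<lambda>t. G t \<bullet> k)"
  shows "continuous_on S G"
proof (rule continuous_on_eq)
  show "continuous_on S (\<lambda>t. \<Sum>i\<in>Basis. (G t \<bullet> i) *\<^sub>R i)"
    by (intro continuous_on_sum continuous_on_scaleR continuous_on_const assms)
qed (rule euclidean_representation)

text \<open>On a Euclidean space the gradient is obtained from the derivative \<open>D\<close> as \<open>adjoint D 1\<close>.\<close>

lemma gradient_inner:
  fixes g :: "'a::euclidean_space \<Rightarrow> real"
  assumes "(g has_derivative D) (at x)"
  shows "gradient g x \<bullet> k = D k"
proof -
  have lin: "linear D" by (rule has_derivative_linear[OF assms])
  have adj: "(\<lambda>h. h \<bullet> adjoint D 1) = D" using adjoint_works[OF lin, of _ 1] by auto
  have "gradient g x = adjoint D 1"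
    unfolding gradient_def gderiv_def
  proof (rule the_equality)
    show "(g has_derivative (\<lambda>h. h \<bullet> adjoint D 1)) (at x)" using assms adj by simp
    fix E assume "(g has_derivative (\<lambda>h. h \<bullet> E)) (at x)"
    from has_derivative_unique[OF this assms] have "h \<bullet> E = h \<bullet> adjoint D 1" for h
      using adj by metis
    then show "E = adjoint D 1" by (metis euclidean_eqI inner_commute)
  qed
  then show ?thesis using adj by (metis inner_commute)
qed

text \<open>
  Joint continuous differentiability of \<open>(x, v, t) \<mapsto> g x v t\<close> up to the boundary of the time interval.
  The three arguments are kept in one product space, so that the partial derivatives in \<open>x\<close> and \<open>v\<close> are
  the values of \<open>g'\<close> at \<open>(k, 0, 0)\<close> and \<open>(0, k, 0)\<close>.
\<close>

locale param_C1 =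
  fixes a b :: real
    and g :: "'x::euclidean_space \<Rightarrow> 'v::euclidean_space \<Rightarrow> real \<Rightarrow> 'y::euclidean_space"
    and g' :: "'x \<times> 'v \<times> real \<Rightarrow> ('x \<times> 'v \<times> real) \<Rightarrow>\<^sub>L 'y"
  assumes deriv: "z \<in> UNIV \<times> UNIV \<times> {a..b} \<Longrightarrow>
      ((\<lambda>(x, v, t). g x v t) has_derivative g' z) (at z within UNIV \<times> UNIV \<times> {a..b})"
    and deriv_cont: "continuous_on (UNIV \<times> UNIV \<times> {a..b}) g'"
begin

lemma continuous_on_along:
  assumes "continuous_on {a..b} q" "continuous_on {a..b} u"
  shows "continuous_on {a..b} (\<lambda>t. g (q t) (u t) t)"
proof -
  have "continuous_on (UNIV \<times> UNIV \<times> {a..b}) (\<lambda>(x, v, t). g x v t)"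
    by (auto simp: continuous_on_eq_continuous_within intro!: has_derivative_continuous[OF deriv])
  then have "continuous_on {a..b} (\<lambda>t. case (q t, u t, t) of (x, v, t) \<Rightarrow> g x v t)"
    by (rule continuous_on_compose2) (auto intro!: continuous_intros assms)
  then show ?thesis by simp
qed

lemma continuous_on_deriv_along:
  assumes "continuous_on {a..b} q" "continuous_on {a..b} u"
  shows "continuous_on {a..b} (\<lambda>t. g' (q t, u t, t))"
  by (rule continuous_on_compose2[OF deriv_cont]) (auto intro!: continuous_intros assms)

lemma has_derivative_state:
  assumes "t \<in> {a..b}"
  shows "((\<lambda>x. g x v t) has_derivative (\<lambda>k. g' (x, v, t) (k, 0, 0))) (at x)"
proof -
  have "((\<lambda>x. case (x, v, t) of (x, v, t) \<Rightarrow> g x v t) has_derivative (\<lambda>k. g' (x, v, t) (k, 0, 0))) (at x)"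
    by (rule has_derivative_in_compose[where g = "\<lambda>(x, v, t). g x v t" and f = "\<lambda>x. (x, v, t)"])
       (use assms in \<open>auto intro!: derivative_eq_intros has_derivative_subset[OF deriv] simp: zero_prod_def\<close>)
  then show ?thesis by simp
qed

lemma has_derivative_control:
  assumes "t \<in> {a..b}"
  shows "((\<lambda>v. g x v t) has_derivative (\<lambda>k. g' (x, v, t) (0, k, 0))) (at v)"
proof -
  have "((\<lambda>v. case (x, v, t) of (x, v, t) \<Rightarrow> g x v t) has_derivative (\<lambda>k. g' (x, v, t) (0, k, 0))) (at v)"
    by (rule has_derivative_in_compose[where g = "\<lambda>(x, v, t). g x v t" and f = "\<lambda>v. (x, v, t)"])
       (use assms in \<open>auto intro!: derivative_eq_intros has_derivative_subset[OF deriv] simp: zero_prod_def\<close>)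
  then show ?thesis by simp
qed

text \<open>
  First-order expansion along the curve \<open>t \<mapsto> (q t, u t, t)\<close> with an error that is uniform in \<open>t\<close>. The
  curve stays in a compact convex set \<open>C\<close>, with distance at least 1 to its boundary in the \<open>x\<close> and \<open>v\<close>
  directions, and \<open>g'\<close> is uniformly continuous on \<open>C\<close>; the mean value inequality on the
  segment between two points of \<open>C\<close> does the rest.
\<close>

lemma uniform_linearization:
  assumes q: "continuous_on {a..b} q" and u: "continuous_on {a..b} u" and e: "0 < e"
  shows "\<exists>d>0. \<forall>t\<in>{a..b}. \<forall>x v. norm (x - q t) \<le> d \<longrightarrow> norm (v - u t) \<le> d \<longrightarrow>
    norm (g x v t - g (q t) (u t) t - g' (q t, u t, t) (x - q t, v - u t, 0))
      \<le> e * (norm (x - q t) + norm (v - u t))"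
proof -
  have "bounded (q ` {a..b})" "bounded (u ` {a..b})"
    by (intro compact_imp_bounded compact_continuous_image q u compact_Icc)+
  then obtain R R' where R: "\<And>t. t \<in> {a..b} \<Longrightarrow> norm (q t) \<le> R"
    and R': "\<And>t. t \<in> {a..b} \<Longrightarrow> norm (u t) \<le> R'"
    unfolding bounded_iff by blast
  define C where "C = cball (0::'x) (R + 1) \<times> cball (0::'v) (R' + 1) \<times> {a..b}"
  have "uniformly_continuous_on C g'"
    by (intro compact_uniformly_continuous continuous_on_subset[OF deriv_cont])
       (auto simp: C_def intro!: compact_Times)
  then obtain d0 where d0: "0 < d0"
    "\<And>y z. y \<in> C \<Longrightarrow> z \<in> C \<Longrightarrow> dist z y < d0 \<Longrightarrow> dist (g' z) (g' y) < e"
    using e unfolding uniformly_continuous_on_def by metis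
  \<comment> \<open>The norm on the product is at most the sum of the norms, hence the factor below one half.\<close>
  define d where "d = min 1 (d0 / 3)"
  have d: "0 < d" "d \<le> 1" "2 * d < d0" using d0(1) by (auto simp: d_def)
  have "norm (g x v t - g (q t) (u t) t - g' (q t, u t, t) (x - q t, v - u t, 0))
      \<le> e * (norm (x - q t) + norm (v - u t))"
    if t: "t \<in> {a..b}" and x: "norm (x - q t) \<le> d" and v: "norm (v - u t) \<le> d" for t x v
  proof -
    define z0 where "z0 = (q t, u t, t)"
    define z1 where "z1 = (x, v, t)"
    define S where "S = closed_segment z0 z1"
    have le: "norm (z1 - z0) \<le> norm (x - q t) + norm (v - u t)"
      using norm_Pair_le[of "x - q t" "(v - u t, 0::real)"] norm_Pair_le[of "v - u t" "0::real"]
      by (simp add: z0_def z1_def)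
    have "convex C" by (auto simp: C_def intro!: convex_Times)
    moreover have "z0 \<in> C" using R[OF t] R'[OF t] t by (simp add: z0_def C_def)
    moreover have "z1 \<in> C"
      using R[OF t] R'[OF t] t x v d(2) norm_triangle_ineq[of "x - q t" "q t"]
        norm_triangle_ineq[of "v - u t" "u t"] by (simp add: z1_def C_def)
    ultimately have SC: "S \<subseteq> C" by (simp add: S_def closed_segment_subset)
    have CU: "C \<subseteq> UNIV \<times> UNIV \<times> {a..b}" by (auto simp: C_def)
    have "norm ((\<lambda>(x, v, t). g x v t) z1 - (\<lambda>(x, v, t). g x v t) z0 - g' z0 (z1 - z0)) \<le> norm (z1 - z0) * e"
    proof (rule differentiable_bound_linearization[of z0 z1 S _ "\<lambda>z. blinfun_apply (g' z)"])
      show "z0 + s *\<^sub>R (z1 - z0) \<in> S" if "s \<in> {0..1}" for s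
        using that by (auto simp: S_def in_segment algebra_simps intro!: exI[of _ s])
      show "((\<lambda>(x, v, t). g x v t) has_derivative g' z) (at z within S)" if "z \<in> S" for z
        using that SC CU by (intro has_derivative_subset[OF deriv]) auto
      show "onorm (blinfun_apply (g' z) - blinfun_apply (g' z0)) \<le> e" if z: "z \<in> S" for z
      proof -
        have "dist z z0 \<le> norm (z1 - z0)"
          using z unfolding S_def by (metis dist_commute dist_in_closed_segment dist_norm)
        then have "dist z z0 < d0" using le x v d(3) by simp
        then have "norm (g' z - g' z0) < e"
          using d0(2)[of z0 z] z SC \<open>z0 \<in> C\<close> by (auto simp: dist_norm)
        then show ?thesis by (simp add: norm_blinfun.rep_eq minus_blinfun.rep_eq fun_diff_def)
      qed
      show "z0 \<in> S" by (simp add: S_def)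
    qed
    also have "\<dots> \<le> (norm (x - q t) + norm (v - u t)) * e"
      using le e by (intro mult_right_mono) auto
    finally show ?thesis by (simp add: z0_def z1_def mult.commute)
  qed
  then show ?thesis using d(1) by blast
qed

end

section \<open>The fractional control problem\<close>

locale frac_control_problem =
  F: param_C1 a b f f' + L: param_C1 a b L L'
  for a b :: real
    and f :: "'x::euclidean_space \<Rightarrow> 'v::euclidean_space \<Rightarrow> real \<Rightarrow> 'x"
    and f' :: "'x \<times> 'v \<times> real \<Rightarrow> ('x \<times> 'v \<times> real) \<Rightarrow>\<^sub>L 'x"
    and L :: "'x \<Rightarrow> 'v \<Rightarrow> real \<Rightarrow> real"
    and L' :: "'x \<times> 'v \<times> real \<Rightarrow> ('x \<times> 'v \<times> real) \<Rightarrow>\<^sub>L real" +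
  fixes \<alpha> M :: real and A :: 'x
  assumes ab: "a < b" and order: "0 < \<alpha>" "\<alpha> \<le> 1" and M_nonneg: "0 \<le> M"
    and Lipschitz: "t \<in> {a..b} \<Longrightarrow> norm (f x1 v t - f x2 v t) \<le> M * norm (x1 - x2)"
begin

abbreviation "K \<equiv> frac_kernel \<alpha> (b - a)"
abbreviation "q \<equiv> state a b \<alpha> A f"
abbreviation "p \<equiv> adjoint_state a b \<alpha> A L f"
abbreviation "H \<equiv> Hamiltonian L f"

sublocale K: causal_kernel K
  using ab order by (intro causal_kernel_frac_kernel) auto

lemma gradient_H_state:
  assumes "t \<in> {a..b}"
  shows "gradient (\<lambda>x. H x v w t) x \<bullet> k = L' (x, v, t) (k, 0, 0) + w \<bullet> f' (x, v, t) (k, 0, 0)"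
  unfolding Hamiltonian_def
  by (rule gradient_inner)
     (auto intro!: derivative_eq_intros L.has_derivative_state F.has_derivative_state assms)

lemma gradient_H_control:
  assumes "t \<in> {a..b}"
  shows "gradient (\<lambda>v. H x v w t) v \<bullet> k = L' (x, v, t) (0, k, 0) + w \<bullet> f' (x, v, t) (0, k, 0)"
  unfolding Hamiltonian_def
  by (rule gradient_inner)
     (auto intro!: derivative_eq_intros L.has_derivative_control F.has_derivative_control assms)

lemma continuous_on_gradient_H:
  assumes x: "continuous_on {a..b} x" and u: "continuous_on {a..b} u" and w: "continuous_on {a..b} w"
  shows "continuous_on {a..b} (\<lambda>t. gradient (\<lambda>x. H x (u t) (w t) t) (x t))"
    and "continuous_on {a..b} (\<lambda>t. gradient (\<lambda>v. H (x t) v (w t) t) (u t))"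
proof -
  note intros = continuous_on_add continuous_on_inner w blinfun.continuous_on continuous_on_const
    L.continuous_on_deriv_along[OF x u] F.continuous_on_deriv_along[OF x u]
  have "continuous_on {a..b} (\<lambda>t. gradient (\<lambda>x. H x (u t) (w t) t) (x t) \<bullet> k)" for k
    by (rule continuous_on_eq[of _ "\<lambda>t. L' (x t, u t, t) (k, 0, 0) + w t \<bullet> f' (x t, u t, t) (k, 0, 0)"])
       (intro intros, simp add: gradient_H_state)
  then show "continuous_on {a..b} (\<lambda>t. gradient (\<lambda>x. H x (u t) (w t) t) (x t))"
    by (rule continuous_on_if_inner)
  have "continuous_on {a..b} (\<lambda>t. gradient (\<lambda>v. H (x t) v (w t) t) (u t) \<bullet> k)" for k
    by (rule continuous_on_eq[of _ "\<lambda>t. L' (x t, u t, t) (0, k, 0) + w t \<bullet> f' (x t, u t, t) (0, k, 0)"])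
       (intro intros, simp add: gradient_H_control)
  then show "continuous_on {a..b} (\<lambda>t. gradient (\<lambda>v. H (x t) v (w t) t) (u t))"
    by (rule continuous_on_if_inner)
qed

text \<open>
  The state is defined by a definite description, so existence and uniqueness must be settled before
  anything is known about it. Restriction to \<open>{a..b}\<close> produces the extensional representative.
\<close>

lemma state_solution:
  assumes u: "continuous_on {a..b} u"
  shows "continuous_on {a..b} (q u)"
    and "t \<in> {a..b} \<Longrightarrow> q u t = A + causal_conv K a b (\<lambda>s. f (q u s) (u s) s) t"
proof -
  have is_state_iff: "is_state a b \<alpha> A f u x \<longleftrightarrow> continuous_on {a..b} x \<and>
      (\<forall>t\<in>{a..b}. x t = A + causal_conv K a b (\<lambda>s. f (x s) (u s) s) t)" for x
    unfolding is_state_def Caputo_left_problem_iff[OF ab order]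
    using F.continuous_on_along[OF _ u, of x] by blast
  have Fc: "continuous_on {a..b} (\<lambda>t. f (x t) (u t) t)" if "continuous_on {a..b} x" for x
    by (rule F.continuous_on_along[OF that u])
  have ab': "a \<le> b" using ab by simp
  have "\<exists>!x. x \<in> extensional {a..b} \<and> is_state a b \<alpha> A f u x"
  proof (rule ex_ex1I)
    have exists: "\<exists>x. continuous_on {a..b} x \<and>
        (\<forall>t\<in>{a..b}. x t = A + causal_conv K a b (\<lambda>s. f (x s) (u s) s) t)"
      by (rule K.Volterra_exists[where F = "\<lambda>t x. f x (u t) t", OF ab' M_nonneg])
         (erule Fc, erule Lipschitz)
    obtain x where x: "continuous_on {a..b} x"
      "\<forall>t\<in>{a..b}. x t = A + causal_conv K a b (\<lambda>s. f (x s) (u s) s) t"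
      using exists by blast
    have "continuous_on {a..b} (restrict x {a..b})"
      by (rule continuous_on_eq[OF x(1)]) simp
    moreover have "restrict x {a..b} t =
        A + causal_conv K a b (\<lambda>s. f (restrict x {a..b} s) (u s) s) t" if t: "t \<in> {a..b}" for t
      using x(2) t causal_conv_cong[of a b "\<lambda>s. f (restrict x {a..b} s) (u s) s" "\<lambda>s. f (x s) (u s) s" K t]
      by simp
    ultimately have "is_state a b \<alpha> A f u (restrict x {a..b})" by (simp add: is_state_iff)
    then show "\<exists>x. x \<in> extensional {a..b} \<and> is_state a b \<alpha> A f u x" by blast
  next
    fix x y
    assume x: "x \<in> extensional {a..b} \<and> is_state a b \<alpha> A f u x"
      and y: "y \<in> extensional {a..b} \<and> is_state a b \<alpha> A f u y"
    show "x = y"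
    proof (rule extensionalityI[of _ "{a..b}"])
      fix t assume t: "t \<in> {a..b}"
      show "x t = y t"
      proof (rule K.Volterra_unique[where F = "\<lambda>t x. f x (u t) t" and A = A, OF ab' M_nonneg])
        show "continuous_on {a..b} x" "continuous_on {a..b} y"
          "\<And>t. t \<in> {a..b} \<Longrightarrow> x t = A + causal_conv K a b (\<lambda>s. f (x s) (u s) s) t"
          "\<And>t. t \<in> {a..b} \<Longrightarrow> y t = A + causal_conv K a b (\<lambda>s. f (y s) (u s) s) t"
          using x y unfolding is_state_iff by blast+
      qed (erule Fc, erule Lipschitz, rule t)
    qed (use x y in auto)
  qed
  from theI'[OF this] have "is_state a b \<alpha> A f u (q u)" by (simp add: state_def)
  then show "continuous_on {a..b} (q u)"
    and "t \<in> {a..b} \<Longrightarrow> q u t = A + causal_conv K a b (\<lambda>s. f (q u s) (u s) s) t"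
    unfolding is_state_iff by blast+
qed

text \<open>
  The adjoint equation is affine in the unknown; its Lipschitz constant \<open>D\<close> is a bound for the
  derivative of \<open>f\<close> along the trajectory.
\<close>

lemma adjoint_solution:
  assumes u: "continuous_on {a..b} u"
  shows "continuous_on {a..b} (p u)"
    and "t \<in> {a..b} \<Longrightarrow>
      p u t = anticausal_conv K a b (\<lambda>s. gradient (\<lambda>x. H x (u s) (p u s) s) (q u s)) t"
proof -
  let ?\<chi> = "\<lambda>t y. gradient (\<lambda>x. H x (u t) y t) (q u t)"
  have q: "continuous_on {a..b} (q u)" by (rule state_solution[OF u])
  have Fc: "continuous_on {a..b} (\<lambda>t. ?\<chi> t (y t))" if "continuous_on {a..b} y" for y
    by (rule continuous_on_gradient_H(1)[OF q u that])
  obtain D where D: "0 \<le> D" "\<And>t. t \<in> {a..b} \<Longrightarrow> norm (f' (q u t, u t, t)) \<le> D"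
    using continuous_on_Icc_bounded[OF F.continuous_on_deriv_along[OF q u]] by blast
  have Lip: "norm (?\<chi> t x - ?\<chi> t y) \<le> D * norm (x - y)" if t: "t \<in> {a..b}" for t x y
  proof -
    \<comment> \<open>The gradient is only known through its inner products; the difference is paired with itself.\<close>
    let ?k = "?\<chi> t x - ?\<chi> t y"
    have "norm ?k * norm ?k = ?k \<bullet> ?k" by (simp add: dot_square_norm power2_eq_square)
    also have "\<dots> = (x - y) \<bullet> f' (q u t, u t, t) (?k, 0, 0)"
      by (subst inner_diff_left) (simp add: gradient_H_state[OF t] inner_diff_left)
    also have "\<dots> \<le> norm (x - y) * (norm (f' (q u t, u t, t)) * norm ?k)"
      using norm_blinfun[of "f' (q u t, u t, t)" "(?k, 0, 0)"]
      by (intro order_trans[OF norm_cauchy_schwarz] mult_left_mono) (auto simp: norm_Pair)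
    also have "\<dots> \<le> norm (x - y) * (D * norm ?k)"
      using D(2)[OF t] by (intro mult_left_mono mult_right_mono) auto
    finally have "norm ?k * norm ?k \<le> (D * norm (x - y)) * norm ?k" by (simp add: ac_simps)
    then show ?thesis
      using D(1) by (cases "norm ?k = 0") (auto simp: mult_le_cancel_right)
  qed
  have is_adjoint_iff: "is_adjoint a b \<alpha> A L f u y \<longleftrightarrow> continuous_on {a..b} y \<and>
      (\<forall>t\<in>{a..b}. y t = 0 + anticausal_conv K a b (\<lambda>s. ?\<chi> s (y s)) t)" for y
    unfolding is_adjoint_def Caputo_right_problem_iff[OF ab order] using Fc[of y] by blast
  have ab': "a \<le> b" using ab by simp
  have "\<exists>!y. y \<in> extensional {a..b} \<and> is_adjoint a b \<alpha> A L f u y"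
  proof (rule ex_ex1I)
    have exists: "\<exists>x. continuous_on {a..b} x \<and>
        (\<forall>t\<in>{a..b}. x t = 0 + anticausal_conv K a b (\<lambda>s. ?\<chi> s (x s)) t)"
      by (rule K.Volterra_exists_anticausal[where F = ?\<chi>, OF ab' D(1)]) (erule Fc, erule Lip)
    obtain x where x: "continuous_on {a..b} x"
      "\<forall>t\<in>{a..b}. x t = 0 + anticausal_conv K a b (\<lambda>s. ?\<chi> s (x s)) t"
      using exists by blast
    have "continuous_on {a..b} (restrict x {a..b})"
      by (rule continuous_on_eq[OF x(1)]) simp
    moreover have "restrict x {a..b} t =
        0 + anticausal_conv K a b (\<lambda>s. ?\<chi> s (restrict x {a..b} s)) t" if t: "t \<in> {a..b}" for t
      using x(2) t anticausal_conv_cong[of a b "\<lambda>s. ?\<chi> s (restrict x {a..b} s)" "\<lambda>s. ?\<chi> s (x s)" K t]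
      by simp
    ultimately have "is_adjoint a b \<alpha> A L f u (restrict x {a..b})" unfolding is_adjoint_iff by blast
    then show "\<exists>x. x \<in> extensional {a..b} \<and> is_adjoint a b \<alpha> A L f u x" by blast
  next
    fix x y
    assume x: "x \<in> extensional {a..b} \<and> is_adjoint a b \<alpha> A L f u x"
      and y: "y \<in> extensional {a..b} \<and> is_adjoint a b \<alpha> A L f u y"
    show "x = y"
    proof (rule extensionalityI[of _ "{a..b}"])
      fix t assume t: "t \<in> {a..b}"
      show "x t = y t"
      proof (rule K.Volterra_unique_anticausal[where F = ?\<chi> and B = 0, OF ab' D(1)])
        show "continuous_on {a..b} x" "continuous_on {a..b} y"
          "\<And>t. t \<in> {a..b} \<Longrightarrow> x t = 0 + anticausal_conv K a b (\<lambda>s. ?\<chi> s (x s)) t"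
          "\<And>t. t \<in> {a..b} \<Longrightarrow> y t = 0 + anticausal_conv K a b (\<lambda>s. ?\<chi> s (y s)) t"
          using x y unfolding is_adjoint_iff by blast+
      qed (erule Fc, erule Lip, rule t)
    qed (use x y in auto)
  qed
  from theI'[OF this] have "is_adjoint a b \<alpha> A L f u (p u)" by (simp add: adjoint_state_def)
  then show "continuous_on {a..b} (p u)"
    and "t \<in> {a..b} \<Longrightarrow> p u t = anticausal_conv K a b (\<lambda>s. ?\<chi> s (p u s)) t"
    unfolding is_adjoint_iff by auto
qed

text \<open>
  The difference of the perturbed and the original state is the fractional integral of a function
  that is bounded by \<open>M\<close> times this difference plus a multiple of \<open>\<bar>\<epsilon>\<bar>\<close>, the effect of changing the
  control at a fixed state; the Gronwall inequality then bounds the difference by a multiple of \<open>\<bar>\<epsilon>\<bar>\<close>.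
\<close>

lemma state_Lipschitz_in_control:
  assumes u: "continuous_on {a..b} u" and w: "continuous_on {a..b} w"
  shows "\<exists>C\<ge>0. \<exists>d>0. \<forall>\<epsilon>. \<bar>\<epsilon>\<bar> < d \<longrightarrow>
    (\<forall>t\<in>{a..b}. norm (q (\<lambda>t. u t + \<epsilon> *\<^sub>R w t) t - q u t) \<le> C * \<bar>\<epsilon>\<bar>)"
proof -
  have q: "continuous_on {a..b} (q u)" by (rule state_solution[OF u])
  have ab': "a \<le> b" using ab by simp
  obtain C where C: "0 \<le> C" "\<And>\<Delta> \<psi> :: real \<Rightarrow> 'x. \<And>\<eta>. \<lbrakk>0 \<le> \<eta>; continuous_on {a..b} \<Delta>; continuous_on {a..b} \<psi>;
      \<forall>t\<in>{a..b}. \<Delta> t = causal_conv K a b \<psi> t; \<forall>t\<in>{a..b}. norm (\<psi> t) \<le> M * norm (\<Delta> t) + \<eta>\<rbrakk>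
      \<Longrightarrow> \<forall>t\<in>{a..b}. norm (\<Delta> t) \<le> C * \<eta>"
    using K.causal_conv_Gronwall[OF ab' M_nonneg] by metis
  obtain D where D: "0 \<le> D" "\<And>t. t \<in> {a..b} \<Longrightarrow> norm (f' (q u t, u t, t)) \<le> D"
    using continuous_on_Icc_bounded[OF F.continuous_on_deriv_along[OF q u]] by blast
  obtain W where W: "0 \<le> W" "\<And>t. t \<in> {a..b} \<Longrightarrow> norm (w t) \<le> W"
    using continuous_on_Icc_bounded[OF w] by blast
  obtain d where d: "0 < d" "\<And>t x v. \<lbrakk>t \<in> {a..b}; norm (x - q u t) \<le> d; norm (v - u t) \<le> d\<rbrakk> \<Longrightarrow>
      norm (f x v t - f (q u t) (u t) t - f' (q u t, u t, t) (x - q u t, v - u t, 0))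
      \<le> 1 * (norm (x - q u t) + norm (v - u t))"
    using F.uniform_linearization[OF q u zero_less_one] by blast
  have "\<forall>t\<in>{a..b}. norm (q (\<lambda>t. u t + \<epsilon> *\<^sub>R w t) t - q u t) \<le> C * ((D + 1) * W) * \<bar>\<epsilon>\<bar>"
    if "\<bar>\<epsilon>\<bar> < d / (W + 1)" for \<epsilon>
  proof -
    have "\<bar>\<epsilon>\<bar> * (W + 1) < d" using that W(1) by (simp add: pos_less_divide_eq)
    then have \<epsilon>: "\<bar>\<epsilon>\<bar> * W \<le> d" by (simp add: distrib_left)
    let ?u = "\<lambda>t. u t + \<epsilon> *\<^sub>R w t"
    have u': "continuous_on {a..b} ?u" by (intro continuous_intros u w)
    let ?\<psi> = "\<lambda>t. f (q ?u t) (?u t) t - f (q u t) (u t) t"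
    have "\<forall>t\<in>{a..b}. norm (q ?u t - q u t) \<le> C * ((D + 1) * W * \<bar>\<epsilon>\<bar>)"
    proof (rule C(2)[of _ _ ?\<psi>])
      show "0 \<le> (D + 1) * W * \<bar>\<epsilon>\<bar>" using D(1) W(1) by simp
      show "continuous_on {a..b} (\<lambda>t. q ?u t - q u t)"
        by (intro continuous_intros state_solution u u')
      show "continuous_on {a..b} ?\<psi>"
        by (intro continuous_intros F.continuous_on_along state_solution u u')
      show "\<forall>t\<in>{a..b}. q ?u t - q u t = causal_conv K a b ?\<psi> t"
      proof
        fix t assume t: "t \<in> {a..b}"
        show "q ?u t - q u t = causal_conv K a b ?\<psi> t"
          using state_solution(2)[OF u t] state_solution(2)[OF u' t]
          by (subst K.causal_conv_diff) (auto intro!: F.continuous_on_along state_solution(1) u u')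
      qed
      show "\<forall>t\<in>{a..b}. norm (?\<psi> t) \<le> M * norm (q ?u t - q u t) + (D + 1) * W * \<bar>\<epsilon>\<bar>"
      proof
        fix t assume t: "t \<in> {a..b}"
        let ?D = "f' (q u t, u t, t) (0, \<epsilon> *\<^sub>R w t, 0)"
        have w': "norm (\<epsilon> *\<^sub>R w t) \<le> \<bar>\<epsilon>\<bar> * W" using W(2)[OF t] by (simp add: mult_left_mono)
        have "norm ?D \<le> norm (f' (q u t, u t, t)) * norm (\<epsilon> *\<^sub>R w t)"
          using norm_blinfun[of "f' (q u t, u t, t)" "(0, \<epsilon> *\<^sub>R w t, 0)"] by (simp add: norm_Pair)
        also have "\<dots> \<le> D * (\<bar>\<epsilon>\<bar> * W)"
          by (intro mult_mono D w' t norm_ge_zero)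
        finally have 1: "norm ?D \<le> D * (\<bar>\<epsilon>\<bar> * W)" .
        have 2: "norm (f (q u t) (?u t) t - f (q u t) (u t) t - ?D) \<le> \<bar>\<epsilon>\<bar> * W"
          using d(2)[OF t, of "q u t" "?u t"] w' \<epsilon> d(1) by simp
        have "norm (f (q u t) (?u t) t - f (q u t) (u t) t) \<le> (D + 1) * W * \<bar>\<epsilon>\<bar>"
          using norm_triangle_ineq[of "f (q u t) (?u t) t - f (q u t) (u t) t - ?D" ?D] 1 2
          by (simp add: algebra_simps)
        moreover have "norm (?\<psi> t) \<le> norm (f (q ?u t) (?u t) t - f (q u t) (?u t) t)
            + norm (f (q u t) (?u t) t - f (q u t) (u t) t)"
          using norm_triangle_ineq[of "f (q ?u t) (?u t) t - f (q u t) (?u t) t" "f (q u t) (?u t) t - f (q u t) (u t) t"]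
          by simp
        ultimately show "norm (?\<psi> t) \<le> M * norm (q ?u t - q u t) + (D + 1) * W * \<bar>\<epsilon>\<bar>"
          using Lipschitz[OF t, of "q ?u t" "?u t" "q u t"] by linarith
      qed
    qed
    then show "\<forall>t\<in>{a..b}. norm (q ?u t - q u t) \<le> C * ((D + 1) * W) * \<bar>\<epsilon>\<bar>"
      by (simp add: ac_simps)
  qed
  moreover have "0 \<le> C * ((D + 1) * W)" "0 < d / (W + 1)" using C(1) D(1) W(1) d(1) by auto
  ultimately show ?thesis by blast
qed

text \<open>
  The variation of the cost. With \<open>\<Delta>\<close> the increment of the state, \<open>\<psi>\<close> that of \<open>f\<close>, \<open>\<chi>\<close> the right-hand
  side of the adjoint equation, and \<open>Rf\<close>, \<open>RL\<close> the remainders of the linearizations of \<open>f\<close> and \<open>L\<close>, the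
  definition of the Hamiltonian gives an identity that holds at every time, stated as \<open>pointwise\<close> in
  the proof. Its first two terms cancel after integration: \<open>\<Delta>\<close> is the left fractional integral of
  \<open>\<psi>\<close> and the adjoint state is the right fractional integral of \<open>\<chi>\<close>, so \<open>\<integral> \<chi> \<bullet> \<Delta> = \<integral> p \<bullet> \<psi>\<close>. What is left besides the linear term
  in \<open>\<epsilon>\<close> are the remainders, which are \<open>o(\<epsilon>)\<close> uniformly in time.
\<close>

lemma cost_has_derivative:
  assumes u: "continuous_on {a..b} u" and w: "continuous_on {a..b} w"
  shows "((\<lambda>\<epsilon>. (cost a b \<alpha> A L f (\<lambda>t. u t + \<epsilon> *\<^sub>R w t) - cost a b \<alpha> A L f u) / \<epsilon>) \<longlongrightarrow>
    integral {a..b} (\<lambda>t. gradient (\<lambda>v. H (q u t) v (p u t) t) (u t) \<bullet> w t)) (at 0)"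
proof -
  let ?J = "cost a b \<alpha> A L f" and ?u = "\<lambda>\<epsilon> t. u t + \<epsilon> *\<^sub>R w t"
  let ?h = "\<lambda>t. gradient (\<lambda>v. H (q u t) v (p u t) t) (u t)"
  let ?\<chi> = "\<lambda>t. gradient (\<lambda>x. H x (u t) (p u t) t) (q u t)"
  note q = state_solution(1)[OF u] and p = adjoint_solution(1)[OF u]
  have u': "continuous_on {a..b} (?u \<epsilon>)" for \<epsilon> by (intro continuous_intros u w)
  note q' = state_solution(1)[OF u']
  note h = continuous_on_gradient_H(2)[OF q u p] and \<chi> = continuous_on_gradient_H(1)[OF q u p]
  let ?\<Delta> = "\<lambda>\<epsilon> t. q (?u \<epsilon>) t - q u t"
  let ?\<psi> = "\<lambda>\<epsilon> t. f (q (?u \<epsilon>) t) (?u \<epsilon> t) t - f (q u t) (u t) t"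
  let ?Rf = "\<lambda>\<epsilon> t. ?\<psi> \<epsilon> t - f' (q u t, u t, t) (?\<Delta> \<epsilon> t, \<epsilon> *\<^sub>R w t, 0)"
  let ?RL = "\<lambda>\<epsilon> t. L (q (?u \<epsilon>) t) (?u \<epsilon> t) t - L (q u t) (u t) t
      - L' (q u t, u t, t) (?\<Delta> \<epsilon> t, \<epsilon> *\<^sub>R w t, 0)"
  have \<psi>: "continuous_on {a..b} (?\<psi> \<epsilon>)" for \<epsilon>
    by (intro continuous_on_diff F.continuous_on_along q q' u u')
  have \<Delta>: "continuous_on {a..b} (?\<Delta> \<epsilon>)" for \<epsilon> by (intro continuous_on_diff q q')
  have \<Delta>_eq: "?\<Delta> \<epsilon> t = causal_conv K a b (?\<psi> \<epsilon>) t" if t: "t \<in> {a..b}" for \<epsilon> t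
    using state_solution(2)[OF u t] state_solution(2)[OF u' t, of \<epsilon>]
    by (subst K.causal_conv_diff) (auto intro!: F.continuous_on_along q q' u u')
  have arg: "continuous_on {a..b} (\<lambda>t. (?\<Delta> \<epsilon> t, \<epsilon> *\<^sub>R w t, 0 :: real))" for \<epsilon>
    by (intro continuous_intros q q' w)
  have Rc: "continuous_on {a..b} (\<lambda>t. ?RL \<epsilon> t + p u t \<bullet> ?Rf \<epsilon> t)" for \<epsilon>
    by (intro continuous_on_add continuous_on_diff continuous_on_inner p q q' u u' arg
        F.continuous_on_along L.continuous_on_along blinfun.continuous_on
        F.continuous_on_deriv_along L.continuous_on_deriv_along)
  have parts: "integral {a..b} (\<lambda>t. ?\<chi> t \<bullet> ?\<Delta> \<epsilon> t) = integral {a..b} (\<lambda>t. p u t \<bullet> ?\<psi> \<epsilon> t)" for \<epsilon>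
  proof -
    have "integral {a..b} (\<lambda>t. ?\<chi> t \<bullet> ?\<Delta> \<epsilon> t) = integral {a..b} (\<lambda>t. ?\<chi> t \<bullet> causal_conv K a b (?\<psi> \<epsilon>) t)"
      by (rule Henstock_Kurzweil_Integration.integral_cong) (simp only: \<Delta>_eq)
    also have "\<dots> = integral {a..b} (\<lambda>t. anticausal_conv K a b ?\<chi> t \<bullet> ?\<psi> \<epsilon> t)"
      by (rule K.integral_causal_conv_by_parts[OF \<chi> \<psi>])
    also have "\<dots> = integral {a..b} (\<lambda>t. p u t \<bullet> ?\<psi> \<epsilon> t)"
      by (rule Henstock_Kurzweil_Integration.integral_cong) (simp only: adjoint_solution(2)[OF u])
    finally show ?thesis .
  qed
  have expansion: "?J (?u \<epsilon>) - ?J u = \<epsilon> * integral {a..b} (\<lambda>t. ?h t \<bullet> w t)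
      + integral {a..b} (\<lambda>t. ?RL \<epsilon> t + p u t \<bullet> ?Rf \<epsilon> t)" for \<epsilon>
  proof -
    have pointwise: "L (q (?u \<epsilon>) t) (?u \<epsilon> t) t - L (q u t) (u t) t =
        (?\<chi> t \<bullet> ?\<Delta> \<epsilon> t - p u t \<bullet> ?\<psi> \<epsilon> t) + (\<epsilon> * (?h t \<bullet> w t) + (?RL \<epsilon> t + p u t \<bullet> ?Rf \<epsilon> t))"
      if t: "t \<in> {a..b}" for t
    proof -
      have split: "(?\<Delta> \<epsilon> t, \<epsilon> *\<^sub>R w t, 0 :: real) = (?\<Delta> \<epsilon> t, 0, 0) + \<epsilon> *\<^sub>R (0, w t, 0)" by simp
      show ?thesis
        unfolding split blinfun.add_right blinfun.scaleR_right gradient_H_state[OF t] gradient_H_control[OF t]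
        by (simp add: inner_diff_right inner_add_right algebra_simps)
    qed
    have I: "(\<lambda>t. ?\<chi> t \<bullet> ?\<Delta> \<epsilon> t) integrable_on {a..b}" "(\<lambda>t. p u t \<bullet> ?\<psi> \<epsilon> t) integrable_on {a..b}"
      "(\<lambda>t. \<epsilon> * (?h t \<bullet> w t)) integrable_on {a..b}"
      "(\<lambda>t. ?RL \<epsilon> t + p u t \<bullet> ?Rf \<epsilon> t) integrable_on {a..b}"
      by (intro integrable_continuous_real continuous_on_mult continuous_on_inner continuous_on_const
          \<chi> \<Delta> p \<psi> h w Rc)+
    have "?J (?u \<epsilon>) - ?J u = integral {a..b} (\<lambda>t. L (q (?u \<epsilon>) t) (?u \<epsilon> t) t - L (q u t) (u t) t)"
      unfolding cost_def
      by (rule integral_diff[symmetric])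
         (intro integrable_continuous_real L.continuous_on_along q q' u u')+
    also have "\<dots> = integral {a..b} (\<lambda>t. (?\<chi> t \<bullet> ?\<Delta> \<epsilon> t - p u t \<bullet> ?\<psi> \<epsilon> t) +
        (\<epsilon> * (?h t \<bullet> w t) + (?RL \<epsilon> t + p u t \<bullet> ?Rf \<epsilon> t)))"
      by (rule Henstock_Kurzweil_Integration.integral_cong) (rule pointwise)
    also have "\<dots> = (integral {a..b} (\<lambda>t. ?\<chi> t \<bullet> ?\<Delta> \<epsilon> t) - integral {a..b} (\<lambda>t. p u t \<bullet> ?\<psi> \<epsilon> t)) +
        (integral {a..b} (\<lambda>t. \<epsilon> * (?h t \<bullet> w t)) + integral {a..b} (\<lambda>t. ?RL \<epsilon> t + p u t \<bullet> ?Rf \<epsilon> t))"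
      by (simp only: integral_add[OF integrable_diff[OF I(1,2)] integrable_add[OF I(3,4)]]
          integral_diff[OF I(1,2)] integral_add[OF I(3,4)])
    finally show ?thesis by (simp add: parts)
  qed
  obtain C d0 where C: "0 \<le> C" "0 < d0"
    "\<And>\<epsilon> t. \<bar>\<epsilon>\<bar> < d0 \<Longrightarrow> t \<in> {a..b} \<Longrightarrow> norm (?\<Delta> \<epsilon> t) \<le> C * \<bar>\<epsilon>\<bar>"
    using state_Lipschitz_in_control[OF u w] by blast
  obtain W where W: "0 \<le> W" "\<And>t. t \<in> {a..b} \<Longrightarrow> norm (w t) \<le> W"
    using continuous_on_Icc_bounded[OF w] by blast
  obtain P where P: "0 \<le> P" "\<And>t. t \<in> {a..b} \<Longrightarrow> norm (p u t) \<le> P"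
    using continuous_on_Icc_bounded[OF p] by blast
  \<comment> \<open>The integral of the remainders will be at most \<open>(e * X) * \<bar>\<epsilon>\<bar>\<close>, with \<open>e\<close> from the linearization.\<close>
  define X where "X = (1 + P) * (C + W) * (b - a)"
  have X: "0 \<le> X" using ab C(1) W(1) P(1) by (simp add: X_def)
  show ?thesis
    unfolding LIM_eq
  proof (intro allI impI)
    fix r :: real assume r: "0 < r"
    define e where "e = r / (X + 1)"
    have e: "0 < e" "e * X < r" using r X by (auto simp: e_def field_simps)
    obtain df where df: "0 < df" "\<And>t x v. \<lbrakk>t \<in> {a..b}; norm (x - q u t) \<le> df; norm (v - u t) \<le> df\<rbrakk> \<Longrightarrow>
        norm (f x v t - f (q u t) (u t) t - f' (q u t, u t, t) (x - q u t, v - u t, 0))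
        \<le> e * (norm (x - q u t) + norm (v - u t))"
      using F.uniform_linearization[OF q u e(1)] by blast
    obtain dL where dL: "0 < dL" "\<And>t x v. \<lbrakk>t \<in> {a..b}; norm (x - q u t) \<le> dL; norm (v - u t) \<le> dL\<rbrakk> \<Longrightarrow>
        norm (L x v t - L (q u t) (u t) t - L' (q u t, u t, t) (x - q u t, v - u t, 0))
        \<le> e * (norm (x - q u t) + norm (v - u t))"
      using L.uniform_linearization[OF q u e(1)] by blast
    define d where "d = min d0 (min df dL / (C + W + 1))"
    have d: "0 < d" using C(1,2) W(1) df(1) dL(1) by (simp add: d_def)
    show "\<exists>s>0. \<forall>\<epsilon>. \<epsilon> \<noteq> 0 \<and> norm (\<epsilon> - 0) < s \<longrightarrow>
        norm ((?J (?u \<epsilon>) - ?J u) / \<epsilon> - integral {a..b} (\<lambda>t. ?h t \<bullet> w t)) < r"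
    proof (intro exI[of _ d] conjI allI impI, rule d)
      fix \<epsilon> :: real assume "\<epsilon> \<noteq> 0 \<and> norm (\<epsilon> - 0) < d"
      then have \<epsilon>: "\<epsilon> \<noteq> 0" "\<bar>\<epsilon>\<bar> < d" by auto
      then have "\<bar>\<epsilon>\<bar> < d0" and "\<bar>\<epsilon>\<bar> * (C + W + 1) < min df dL"
        using C(1) W(1) by (auto simp: d_def pos_less_divide_eq)
      then have "C * \<bar>\<epsilon>\<bar> + W * \<bar>\<epsilon>\<bar> + \<bar>\<epsilon>\<bar> < min df dL"
        by (simp only: distrib_left mult.commute mult_1_right)
      then have small: "C * \<bar>\<epsilon>\<bar> \<le> min df dL" "W * \<bar>\<epsilon>\<bar> \<le> min df dL"
        using mult_nonneg_nonneg[OF C(1) abs_ge_zero[of \<epsilon>]] mult_nonneg_nonneg[OF W(1) abs_ge_zero[of \<epsilon>]]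
          abs_ge_zero[of \<epsilon>] by linarith+
      have "norm (?RL \<epsilon> t + p u t \<bullet> ?Rf \<epsilon> t) \<le> (1 + P) * (e * ((C + W) * \<bar>\<epsilon>\<bar>))" if t: "t \<in> {a..b}" for t
      proof -
        have \<Delta>t: "norm (?\<Delta> \<epsilon> t) \<le> C * \<bar>\<epsilon>\<bar>" by (rule C(3)[OF \<open>\<bar>\<epsilon>\<bar> < d0\<close> t])
        have wt: "norm (?u \<epsilon> t - u t) \<le> W * \<bar>\<epsilon>\<bar>" using mult_right_mono[OF W(2)[OF t] abs_ge_zero[of \<epsilon>]] by (simp add: mult.commute)
        have sum: "e * (norm (?\<Delta> \<epsilon> t) + norm (?u \<epsilon> t - u t)) \<le> e * ((C + W) * \<bar>\<epsilon>\<bar>)"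
          using add_mono[OF \<Delta>t wt] e(1) by (intro mult_left_mono) (simp_all only: distrib_right less_imp_le)
        have le_df: "norm (?\<Delta> \<epsilon> t) \<le> df" "norm (?u \<epsilon> t - u t) \<le> df"
          and le_dL: "norm (?\<Delta> \<epsilon> t) \<le> dL" "norm (?u \<epsilon> t - u t) \<le> dL"
          using order_trans[OF \<Delta>t small(1)] order_trans[OF wt small(2)] by (simp_all only: min.bounded_iff)
        have Rf: "norm (?Rf \<epsilon> t) \<le> e * ((C + W) * \<bar>\<epsilon>\<bar>)"
          using df(2)[OF t le_df] sum by (simp only: add_diff_cancel_left')
        have RL: "norm (?RL \<epsilon> t) \<le> e * ((C + W) * \<bar>\<epsilon>\<bar>)"
          using dL(2)[OF t le_dL] sum by (simp only: add_diff_cancel_left')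
        have "norm (p u t \<bullet> ?Rf \<epsilon> t) \<le> norm (p u t) * norm (?Rf \<epsilon> t)"
          by (simp only: real_norm_def Cauchy_Schwarz_ineq2)
        also have "\<dots> \<le> P * (e * ((C + W) * \<bar>\<epsilon>\<bar>))"
          by (intro mult_mono P Rf t norm_ge_zero)
        finally have "norm (?RL \<epsilon> t + p u t \<bullet> ?Rf \<epsilon> t) \<le>
            e * ((C + W) * \<bar>\<epsilon>\<bar>) + P * (e * ((C + W) * \<bar>\<epsilon>\<bar>))"
          using RL by (intro order_trans[OF norm_triangle_ineq] add_mono)
        then show ?thesis by (simp only: distrib_right mult_1)
      qed
      from integral_bound[OF less_imp_le[OF ab] Rc this]
      have "norm (integral {a..b} (\<lambda>t. ?RL \<epsilon> t + p u t \<bullet> ?Rf \<epsilon> t)) \<le> (e * X) * \<bar>\<epsilon>\<bar>"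
        unfolding X_def by (simp only: ac_simps)
      also have "\<dots> < r * \<bar>\<epsilon>\<bar>" using e(2) \<epsilon>(1) by simp
      finally have *: "norm (integral {a..b} (\<lambda>t. ?RL \<epsilon> t + p u t \<bullet> ?Rf \<epsilon> t)) < r * \<bar>\<epsilon>\<bar>" .
      have "(?J (?u \<epsilon>) - ?J u) / \<epsilon> - integral {a..b} (\<lambda>t. ?h t \<bullet> w t) =
          integral {a..b} (\<lambda>t. ?RL \<epsilon> t + p u t \<bullet> ?Rf \<epsilon> t) / \<epsilon>"
        unfolding expansion using \<epsilon>(1) by (simp add: add_divide_distrib)
      then show "norm ((?J (?u \<epsilon>) - ?J u) / \<epsilon> - integral {a..b} (\<lambda>t. ?h t \<bullet> w t)) < r"
        using * \<epsilon>(1) by (simp add: pos_divide_less_eq)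
    qed
  qed
qed

text \<open>
  The function \<open>t \<mapsto> \<partial>H/\<partial>v\<close> along the trajectory is continuous on \<open>{a..b}\<close>, hence itself an admissible
  perturbation; testing with it shows that it vanishes at every critical point.
\<close>

theorem critical_point_iff_stationary:
  assumes u: "continuous_on {a..b} u"
  shows "critical_point a b (cost a b \<alpha> A L f) u \<longleftrightarrow> solves_stationary a b H (q u) u (p u)"
proof
  let ?h = "\<lambda>t. gradient (\<lambda>v. H (q u t) v (p u t) t) (u t)"
  have h: "continuous_on {a..b} ?h"
    by (rule continuous_on_gradient_H(2)[OF state_solution(1)[OF u] u adjoint_solution(1)[OF u]])
  {
    assume "critical_point a b (cost a b \<alpha> A L f) u"
    from LIM_unique[OF cost_has_derivative[OF u h] this[unfolded critical_point_def, rule_format, OF h]]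
    have "integral {a..b} (\<lambda>t. ?h t \<bullet> ?h t) = 0" .
    moreover have "continuous_on {a..b} (\<lambda>t. ?h t \<bullet> ?h t)" by (intro continuous_on_inner h)
    ultimately have "\<forall>t\<in>{a..b}. ?h t \<bullet> ?h t = 0"
      using ab by (subst (asm) integral_eq_0_iff) auto
    then show "solves_stationary a b H (q u) u (p u)" by (simp add: solves_stationary_def)
  }
  {
    assume s: "solves_stationary a b H (q u) u (p u)"
    have "integral {a..b} (\<lambda>t. ?h t \<bullet> w t) = integral {a..b} (\<lambda>t. 0)" for w
      by (rule Henstock_Kurzweil_Integration.integral_cong) (use s in \<open>simp add: solves_stationary_def\<close>)
    then have zero: "integral {a..b} (\<lambda>t. ?h t \<bullet> w t) = 0" for w by (simp only: integral_0)
    show "critical_point a b (cost a b \<alpha> A L f) u"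
      unfolding critical_point_def
    proof (intro allI impI)
      fix w :: "real \<Rightarrow> 'v" assume "continuous_on {a..b} w"
      from cost_has_derivative[OF u this]
      show "((\<lambda>\<epsilon>. (cost a b \<alpha> A L f (\<lambda>t. u t + \<epsilon> *\<^sub>R w t) - cost a b \<alpha> A L f u) / \<epsilon>) \<longlongrightarrow> 0) (at 0)"
        by (simp only: zero)
    qed
  }
qed

end

theorem theorem6:
  fixes a b \<alpha> M :: real
    and A :: "real ^ 'd"
    and f :: "real ^ 'd \<Rightarrow> real ^ 'm \<Rightarrow> real \<Rightarrow> real ^ 'd"
    and L :: "real ^ 'd \<Rightarrow> real ^ 'm \<Rightarrow> real \<Rightarrow> real"
    and u :: "real \<Rightarrow> real ^ 'm"
  assumes "a < b"
    and "0 < \<alpha>" and "\<alpha> \<le> 1"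
    and "C2_on (UNIV \<times> UNIV \<times> {a..b}) (\<lambda>(x, v, t). f x v t)"
    and "M \<ge> 0"
    and "\<And>x1 x2 v t. t \<in> {a..b} \<Longrightarrow> norm (f x1 v t - f x2 v t) \<le> M * norm (x1 - x2)"
    and "C2_on (UNIV \<times> UNIV \<times> {a..b}) (\<lambda>(x, v, t). L x v t)"
    and "continuous_on {a..b} u"
  shows "critical_point a b (cost a b \<alpha> A L f) u \<longleftrightarrow>
         solves_stationary a b (Hamiltonian L f)
           (state a b \<alpha> A f u) u (adjoint_state a b \<alpha> A L f u)"
proof -
  obtain f' :: "(real ^ 'd) \<times> (real ^ 'm) \<times> real \<Rightarrow> ((real ^ 'd) \<times> (real ^ 'm) \<times> real) \<Rightarrow>\<^sub>L (real ^ 'd)"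
    where f': "\<forall>z\<in>UNIV \<times> UNIV \<times> {a..b}.
        ((\<lambda>(x, v, t). f x v t) has_derivative f' z) (at z within UNIV \<times> UNIV \<times> {a..b})"
      "C1_on (UNIV \<times> UNIV \<times> {a..b}) f'"
    using assms(4) unfolding C2_on_def by blast
  obtain L' :: "(real ^ 'd) \<times> (real ^ 'm) \<times> real \<Rightarrow> ((real ^ 'd) \<times> (real ^ 'm) \<times> real) \<Rightarrow>\<^sub>L real"
    where L': "\<forall>z\<in>UNIV \<times> UNIV \<times> {a..b}.
        ((\<lambda>(x, v, t). L x v t) has_derivative L' z) (at z within UNIV \<times> UNIV \<times> {a..b})"
      "C1_on (UNIV \<times> UNIV \<times> {a..b}) L'"
    using assms(7) unfolding C2_on_def by blast
  interpret frac_control_problem a b f f' L L' \<alpha> M A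
  proof unfold_locales
    show "continuous_on (UNIV \<times> UNIV \<times> {a..b}) f'" "continuous_on (UNIV \<times> UNIV \<times> {a..b}) L'"
      by (intro continuous_on_C1_on f'(2) L'(2))+
    fix z :: "(real ^ 'd) \<times> (real ^ 'm) \<times> real" assume z: "z \<in> UNIV \<times> UNIV \<times> {a..b}"
    show "((\<lambda>(x, v, t). f x v t) has_derivative f' z) (at z within UNIV \<times> UNIV \<times> {a..b})"
      by (rule bspec[OF f'(1) z])
    show "((\<lambda>(x, v, t). L x v t) has_derivative L' z) (at z within UNIV \<times> UNIV \<times> {a..b})"
      by (rule bspec[OF L'(1) z])
  qed (fact assms)+
  show ?thesis by (rule critical_point_iff_stationary[OF assms(8)])
qed

end
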